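(* Let $f=f(u,v)$ be a generalized timelike minimal surface with real Weierstrass data $(g_1,g_2,\hat{\omega}_1du,\hat{\omega}_2dv)$ and let $p$ be a non-degenerate singular point with $\operatorname{rank}(df_p)=1$ and $\hat\omega_2(p)=0$. If $f$ is not a front at $p$, then $f$ is $\mathcal{A}$-equivalent at $p$ to the $(2,5)$-cuspidal edge if and only if \[ \left(\frac{(g_2)_{vv}}{(\hat{\omega}_2)_v}\right)_v(p)\neq0. \]
   Context: $\mathbb{L}^3$ is $\mathbb{R}^3$ with the Lorentzian metric $\langle\,,\rangle=-dt^2+dx^2+dy^2$. A generalized timelike minimal surface is a non-constant smooth map $f\colon\Sigma\to\mathbb{L}^3$ from a 2-manifold which is an immersion on an open dense subset and such that near each point there are local coordinates $(u,v)$ with $\langle f_u,f_u\rangle=\langle f_v,f_v\rangle=0$ and $f_{uv}=0$. In such coordinates $f(u,v)=\tfrac12\int_{u_0}^u(-1-g_1^2,1-g_1^2,2g_1)\hat{\omega}_1du+\tfrac12\int_{v_0}^v(1+g_2^2,1-g_2^2,-2g_2)\hat{\omega}_2dv+f(u_0,v_0)$, with $g_1,\hat\omega_1$ functions of $u$ and $g_2,\hat\omega_2$ functions of $v$ (real Weierstrass data). Standing assumption: $g_1,g_2$ take finite real values at every singular point. Such $f$ is a frontal with unit normal $n=(g_1+g_2,-g_1+g_2,1+g_1g_2)/\sqrt{(1-g_1g_2)^2+2(g_1+g_2)^2}$; $f$ is a front at $p$ if $(f,n)$ is an immersion at $p$. With $\lambda=\det(f_u,f_v,n)$, a singular point is non-degenerate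 if $d\lambda_p\neq0$ (for such $p$ this is equivalent to $(\hat\omega_2)_v(p)\ne0$ and $g_1g_2(p)\ne1$). $\mathcal{A}$-equivalence means equality of map germs up to diffeomorphism germs of source and target. The $(2,5)$-cuspidal edge is the germ at $0$ of $(u,v)\mapsto(u,v^2,v^5)$. *)

theory Defs
  imports "HOL-Analysis.Analysis"
begin

fun Ck :: "nat \<Rightarrow> 'a::euclidean_space set \<Rightarrow> ('a \<Rightarrow> 'b::real_normed_vector) \<Rightarrow> bool" where
  "Ck 0 S f = continuous_on S f"
| "Ck (Suc k) S f =
     ((\<forall>x\<in>S. f differentiable (at x)) \<and>
      (\<forall>i\<in>Basis. Ck k S (\<lambda>x. frechet_derivative f (at x) i)))"

definition smooth_on :: "'a::euclidean_space set \<Rightarrow> ('a \<Rightarrow> 'b::real_normed_vector) \<Rightarrow> bool" where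
  "smooth_on S f \<longleftrightarrow> (\<forall>k. Ck k S f)"

definition immersion_at :: "('a::euclidean_space \<Rightarrow> 'b::euclidean_space) \<Rightarrow> 'a \<Rightarrow> bool" where
  "immersion_at F x \<longleftrightarrow> (\<exists>D. (F has_derivative D) (at x) \<and> inj D)"

definition rank_d :: "('a::euclidean_space \<Rightarrow> 'b::euclidean_space) \<Rightarrow> 'a \<Rightarrow> nat" where
  "rank_d F x = dim (range (frechet_derivative F (at x)))"

definition local_diffeo_at :: "('a::euclidean_space \<Rightarrow> 'a) \<Rightarrow> 'a \<Rightarrow> bool" where
  "local_diffeo_at \<phi> x \<longleftrightarrow>
     (\<exists>U V \<psi>. open U \<and> x \<in> U \<and> open V \<and> \<phi> ` U = V \<and>
        smooth_on U \<phi> \<and> smooth_on V \<psi> \<and>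
        (\<forall>y\<in>U. \<psi> (\<phi> y) = y) \<and> (\<forall>z\<in>V. \<phi> (\<psi> z) = z))"

definition A_equivalent_at ::
  "('a::euclidean_space \<Rightarrow> 'b::euclidean_space) \<Rightarrow> 'a \<Rightarrow> ('a \<Rightarrow> 'b) \<Rightarrow> 'a \<Rightarrow> bool" where
  "A_equivalent_at F p H q \<longleftrightarrow>
     (\<exists>\<sigma> \<tau> U. open U \<and> p \<in> U \<and> \<sigma> p = q \<and> \<tau> (F p) = H q \<and>
        local_diffeo_at \<sigma> p \<and> local_diffeo_at \<tau> (F p) \<and>
        (\<forall>x\<in>U. \<tau> (F x) = H (\<sigma> x)))"

definition cuspidal_edge_25 :: "real \<times> real \<Rightarrow> real^3" where
  "cuspidal_edge_25 = (\<lambda>(u,v). vector [u, v^2, v^5])"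

definition oint :: "real \<Rightarrow> real \<Rightarrow> (real \<Rightarrow> real^3) \<Rightarrow> real^3" where
  "oint a b g = (if a \<le> b then integral {a..b} g else - integral {b..a} g)"

definition weierstrass ::
  "(real \<Rightarrow> real) \<Rightarrow> (real \<Rightarrow> real) \<Rightarrow> (real \<Rightarrow> real) \<Rightarrow> (real \<Rightarrow> real) \<Rightarrow>
   real \<Rightarrow> real \<Rightarrow> real^3 \<Rightarrow> real \<times> real \<Rightarrow> real^3" where
  "weierstrass g1 w1 g2 w2 u0 v0 c = (\<lambda>(u,v).
      (1/2) *\<^sub>R oint u0 u (\<lambda>s. w1 s *\<^sub>R vector [-1 - (g1 s)^2, 1 - (g1 s)^2, 2 * g1 s])
    + (1/2) *\<^sub>R oint v0 v (\<lambda>s. w2 s *\<^sub>R vector [1 + (g2 s)^2, 1 - (g2 s)^2, -2 * g2 s])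
    + c)"

definition wnormal :: "(real \<Rightarrow> real) \<Rightarrow> (real \<Rightarrow> real) \<Rightarrow> real \<times> real \<Rightarrow> real^3" where
  "wnormal g1 g2 = (\<lambda>(u,v).
     (1 / sqrt ((1 - g1 u * g2 v)^2 + 2 * (g1 u + g2 v)^2)) *\<^sub>R
       vector [g1 u + g2 v, - g1 u + g2 v, 1 + g1 u * g2 v])"

definition lambda_fn :: "(real \<times> real \<Rightarrow> real^3) \<Rightarrow> (real \<times> real \<Rightarrow> real^3) \<Rightarrow> real \<times> real \<Rightarrow> real" where
  "lambda_fn f n = (\<lambda>x. det (vector [frechet_derivative f (at x) (1,0),
                                     frechet_derivative f (at x) (0,1), n x] :: real^3^3))"

definition front_at :: "(real \<times> real \<Rightarrow> real^3) \<Rightarrow> (real \<times> real \<Rightarrow> real^3) \<Rightarrow> real \<times> real \<Rightarrow> bool" where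
  "front_at f n p \<longleftrightarrow> immersion_at (\<lambda>x. (f x, n x)) p"

definition nondegenerate_singular :: "(real \<times> real \<Rightarrow> real^3) \<Rightarrow> (real \<times> real \<Rightarrow> real^3) \<Rightarrow> real \<times> real \<Rightarrow> bool" where
  "nondegenerate_singular f n p \<longleftrightarrow>
     \<not> immersion_at f p \<and> lambda_fn f n differentiable (at p) \<and>
     (\<exists>w. frechet_derivative (lambda_fn f n) (at p) w \<noteq> 0)"

definition gen_timelike_minimal ::
  "real set \<Rightarrow> real set \<Rightarrow> (real \<Rightarrow> real) \<Rightarrow> (real \<Rightarrow> real) \<Rightarrow> (real \<Rightarrow> real) \<Rightarrow> (real \<Rightarrow> real) \<Rightarrow>
   real \<Rightarrow> real \<Rightarrow> real^3 \<Rightarrow> bool" where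
  "gen_timelike_minimal I J g1 w1 g2 w2 u0 v0 c \<longleftrightarrow>
     (let f = weierstrass g1 w1 g2 w2 u0 v0 c in
       is_interval I \<and> open I \<and> is_interval J \<and> open J \<and> u0 \<in> I \<and> v0 \<in> J \<and>
       smooth_on I g1 \<and> smooth_on I w1 \<and> smooth_on J g2 \<and> smooth_on J w2 \<and>
       (\<exists>x\<in>I \<times> J. \<exists>y\<in>I \<times> J. f x \<noteq> f y) \<and>
       (\<exists>R. open R \<and> R \<subseteq> I \<times> J \<and> I \<times> J \<subseteq> closure R \<and> (\<forall>x\<in>R. immersion_at f x)))"

end

theory Submission
  imports Defs
begin

text \<open>
  In null coordinates $f(u,v) = A(u) + B(v)$ with $B' = \frac12 w\, b(g)$, where $w = \hat\omega_2$, $g = g_2$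
  and $b(g) = (1+g^2, 1-g^2, -2g)$. At a non-degenerate singular point $p$ with $w(p) = 0$ one has
  $w'(p) \neq 0$, and $f$ fails to be a front exactly when $g'(p) = 0$. The criterion is then
  $g''' w' - g'' w'' \neq 0$ at $p$.

  Necessity: if $h$ is the third component of the target diffeomorphism, then $h(f(u_p,v)) = y(v)^5$ with
  $y'(p) \neq 0$. Differentiating along the null curve, $5 y^4 y' = w m$ and $m' = w X + g' Y$, where
  $X$ and $Y$ have vanishing derivative at $p$. As $m$ vanishes to order exactly $3$, this gives
  $w' X + g'' Y = 0$ and $w'' X + g''' Y \neq 0$ at $p$.

  Sufficiency: after a Moebius change of the parameter one may assume $w''(p) = 0$. Then the odd part of $B$
  vanishes to order $5$, so $B = E(s^2) + s^5 F(s^2)$ with smooth $E$ and $F$ by Whitney's theorem on even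
  functions, and $f = \Phi(u - u_p, s^2, s^5)$ for $\Phi(x,y,z) = A(u_p + x) + E(y) + z F(y)$. The differential
  of $\Phi$ at $0$ is invertible because of the criterion and $g_1 g_2 \neq 1$.
\<close>

section \<open>Smooth maps on open sets and the inverse function theorem\<close>

text \<open>Necessity: since w and g' vanish at p, the curve (rho, g) with rho = f(u_p, v) has zero
  velocity there. This is why X and Y, being smooth functions of (rho, g), have vanishing derivative
  at p. The unknown target diffeomorphism therefore enters the two lowest coefficients of m' only
  through the numbers X(p) and Y(p), and the two resulting relations are incompatible once (w'',
  g''') is a multiple of (w', g'').

  Sufficiency: at p one has B' = 0 and B''' = w'' b(g) / 2, so w'' alone keeps the odd part from
  having order 5. A parameter change v = v_p + s + kappa s^2 + ... adds 6 kappa w' to the second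
  derivative of the weight, which fixes kappa; a Moebius map offers this freedom together with an
  explicit inverse. Afterwards the fifth derivative is (w'''' b + 4 w' g''' b') / 2, and its b-part
  is parallel to B'' = w' b / 2, so only g''' of the new data decides. Although s^2 takes no
  negative values, E and F must be smooth on both sides of 0, because Phi has to be a diffeomorphism
  on a full neighbourhood; this is where Borel's lemma enters.\<close>

lemma Ck_cong:
  assumes "open S" "\<And>x. x \<in> S \<Longrightarrow> f x = g x" "Ck k S f"
  shows "Ck k S g"
  using assms(2,3)
proof (induction k arbitrary: f g)
  case 0
  then show ?case using continuous_on_cong[of S S f g] by auto
next
  case (Suc k)
  have fd: "f differentiable (at x)" if "x \<in> S" for x using Suc.prems that by auto
  have 1: "frechet_derivative f (at x) = frechet_derivative g (at x)" if "x \<in> S" for x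
    using frechet_derivative_transform_within_open[OF fd \<open>open S\<close>] Suc.prems(1) that by metis
  have 2: "g differentiable (at x)" if "x \<in> S" for x
  proof -
    from fd[OF that] obtain D where "(f has_derivative D) (at x)" unfolding differentiable_def ..
    from has_derivative_transform_within_open[OF this \<open>open S\<close> that Suc.prems(1)]
    show ?thesis by (auto simp: differentiable_def)
  qed
  have "Ck k S (\<lambda>x. frechet_derivative g (at x) i)" if i: "i \<in> Basis" for i
    by (rule Suc.IH[where f = "\<lambda>x. frechet_derivative f (at x) i"]) (use 1 Suc.prems i in auto)
  with 2 show ?case by auto
qed

lemma Ck_subset: "T \<subseteq> S \<Longrightarrow> Ck k S f \<Longrightarrow> Ck k T f"
  by (induction k arbitrary: f) (auto intro: continuous_on_subset)

lemma Ck_SucD: "Ck (Suc k) S f \<Longrightarrow> Ck k S f"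
proof (induction k arbitrary: f)
  case 0
  then show ?case
    by (auto intro!: continuous_at_imp_continuous_on differentiable_imp_continuous_within)
next
  case (Suc k)
  then show ?case by (metis Ck.simps(2))
qed

text \<open>The definition of \<open>Ck\<close> speaks of \<open>frechet_derivative\<close>. Here
  any derivative delivered by the calculus rules may stand in for it, so that each closure property
  below becomes an induction on k.\<close>

lemma Ck_SucI:
  assumes "open S" "\<And>x. x \<in> S \<Longrightarrow> (f has_derivative f' x) (at x)"
    "\<And>i. i \<in> Basis \<Longrightarrow> Ck k S (\<lambda>x. f' x i)"
  shows "Ck (Suc k) S f"
proof -
  have "f' x = frechet_derivative f (at x)" if "x \<in> S" for x
    using assms(2) that frechet_derivative_at by blast
  then have "Ck k S (\<lambda>x. frechet_derivative f (at x) i)" if "i \<in> Basis" for i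
    using Ck_cong[OF assms(1) _ assms(3)[OF that]] by simp
  then show ?thesis using assms(2) by (auto simp: differentiable_def)
qed

lemma Ck_SucD_derivative:
  assumes "Ck (Suc k) S f" "x \<in> S"
  shows "(f has_derivative frechet_derivative f (at x)) (at x)"
  using assms frechet_derivative_works by auto

lemma Ck_const: "open S \<Longrightarrow> Ck k S (\<lambda>x. c)"
proof (induction k arbitrary: c)
  case (Suc k)
  show ?case by (rule Ck_SucI[where f' = "\<lambda>_ _. 0"]) (use Suc in auto)
qed auto

lemma Ck_bounded_linear_compose:
  assumes "open S" "bounded_linear L" "Ck k S f"
  shows "Ck k S (\<lambda>x. L (f x))"
  using assms(3)
proof (induction k arbitrary: f)
  case 0
  then show ?case using bounded_linear.continuous_on[OF assms(2)] by auto
next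
  case (Suc k)
  show ?case
    by (rule Ck_SucI[OF assms(1) bounded_linear.has_derivative[OF assms(2) Ck_SucD_derivative[OF Suc.prems]]])
      (use Suc in auto)
qed

lemma Ck_ident: "open S \<Longrightarrow> Ck k S (\<lambda>x. x)"
proof (cases k)
  case (Suc l)
  assume "open S"
  then show ?thesis unfolding Suc
    by (intro Ck_SucI[where f' = "\<lambda>_ x. x"]) (auto intro: Ck_const)
qed auto

lemma Ck_add:
  assumes "open S" "Ck k S f" "Ck k S g"
  shows "Ck k S (\<lambda>x. f x + g x)"
  using assms(2,3)
proof (induction k arbitrary: f g)
  case 0
  then show ?case by (auto intro: continuous_on_add)
next
  case (Suc k)
  show ?case
    by (rule Ck_SucI[OF assms(1) has_derivative_add[OF Ck_SucD_derivative[OF Suc.prems(1)]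
              Ck_SucD_derivative[OF Suc.prems(2)]]])
      (use Suc in auto)
qed

lemma Ck_bilinear:
  assumes "open S" "bounded_bilinear B" "Ck k S f" "Ck k S g"
  shows "Ck k S (\<lambda>x. B (f x) (g x))"
  using assms(3,4)
proof (induction k arbitrary: f g)
  case 0
  then show ?case using bounded_bilinear.continuous_on[OF assms(2)] by auto
next
  case (Suc k)
  show ?case
  proof (rule Ck_SucI[OF assms(1) bounded_bilinear.FDERIV[OF assms(2)
            Ck_SucD_derivative[OF Suc.prems(1)] Ck_SucD_derivative[OF Suc.prems(2)]]])
    fix i :: 'a assume i: "i \<in> Basis"
    have "Ck k S (\<lambda>x. frechet_derivative f (at x) i)" "Ck k S (\<lambda>x. frechet_derivative g (at x) i)"
      using Suc.prems i by simp_all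
    then show "Ck k S (\<lambda>x. B (f x) (frechet_derivative g (at x) i) + B (frechet_derivative f (at x) i) (g x))"
      by (intro Ck_add[OF assms(1)] Suc.IH Ck_SucD[OF Suc.prems(1)] Ck_SucD[OF Suc.prems(2)])
  qed
qed

lemma Ck_sum:
  assumes "open S" "\<And>i. i \<in> I \<Longrightarrow> Ck k S (f i)"
  shows "Ck k S (\<lambda>x. \<Sum>i\<in>I. f i x)"
  using assms(2)
  by (induction I rule: infinite_finite_induct) (auto intro: Ck_const[OF assms(1)] Ck_add[OF assms(1)])

lemma Ck_prod:
  fixes f :: "'i \<Rightarrow> 'a::euclidean_space \<Rightarrow> real"
  assumes "open S" "\<And>i. i \<in> I \<Longrightarrow> Ck k S (f i)"
  shows "Ck k S (\<lambda>x. \<Prod>i\<in>I. f i x)"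
  using assms(2)
  by (induction I rule: infinite_finite_induct)
    (auto intro: Ck_const[OF assms(1)] Ck_bilinear[OF assms(1) bounded_bilinear_mult])

lemma Ck_componentwise:
  fixes f :: "'a::euclidean_space \<Rightarrow> 'b::euclidean_space"
  assumes "open S" "\<And>b. b \<in> Basis \<Longrightarrow> Ck k S (\<lambda>x. f x \<bullet> b)"
  shows "Ck k S f"
proof -
  have "Ck k S (\<lambda>x. \<Sum>b\<in>Basis. (f x \<bullet> b) *\<^sub>R b)"
    by (intro Ck_sum Ck_bounded_linear_compose[OF _ bounded_linear_scaleR_left] assms)
  then show ?thesis by (simp add: euclidean_representation)
qed

text \<open>\<open>Ck\<close> controls derivatives in basis directions only. The inner derivative is
  therefore expanded in the basis, which turns the chain rule into a sum of products of k times
  differentiable functions, within reach of the induction hypothesis.\<close>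

lemma Ck_compose:
  fixes g :: "'a::euclidean_space \<Rightarrow> 'b::euclidean_space" and f :: "'b \<Rightarrow> 'c::real_normed_vector"
  assumes "open S" "open T" "g ` S \<subseteq> T" "Ck k T f" "Ck k S g"
  shows "Ck k S (\<lambda>x. f (g x))"
  using assms(4,5)
proof (induction k arbitrary: f)
  case 0
  then show ?case using continuous_on_compose2[OF _ _ assms(3), of f] by auto
next
  case (Suc k)
  have g: "(g has_derivative frechet_derivative g (at x)) (at x)" if "x \<in> S" for x
    using Ck_SucD_derivative[OF Suc.prems(2) that] .
  have f: "(f has_derivative frechet_derivative f (at (g x))) (at (g x))" if "x \<in> S" for x
    using Ck_SucD_derivative[OF Suc.prems(1)] that assms(3) by auto
  show ?case
  proof (rule Ck_SucI[OF assms(1)])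
    show "((\<lambda>x. f (g x)) has_derivative
       (\<lambda>i. \<Sum>b\<in>Basis. (frechet_derivative g (at x) i \<bullet> b) *\<^sub>R frechet_derivative f (at (g x)) b)) (at x)"
      if "x \<in> S" for x
    proof -
      have "frechet_derivative f (at (g x)) (frechet_derivative g (at x) i) =
        (\<Sum>b\<in>Basis. (frechet_derivative g (at x) i \<bullet> b) *\<^sub>R frechet_derivative f (at (g x)) b)" for i
      proof -
        have "linear (frechet_derivative f (at (g x)))"
          using f[OF that] has_derivative_linear by blast
        then show ?thesis
          by (subst euclidean_representation[symmetric, of "frechet_derivative g (at x) i"])
            (simp add: linear_sum linear_cmul)
      qed
      then show ?thesis using has_derivative_compose[OF g[OF that] f[OF that]] by simp
    qed
    fix i :: 'a assume i: "i \<in> Basis"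
    show "Ck k S (\<lambda>x. \<Sum>b\<in>Basis. (frechet_derivative g (at x) i \<bullet> b) *\<^sub>R frechet_derivative f (at (g x)) b)"
    proof (intro Ck_sum assms Ck_bilinear[OF _ bounded_bilinear_scaleR]
          Ck_bounded_linear_compose[OF _ bounded_linear_inner_left] Suc.IH Ck_SucD[OF Suc.prems(2)])
      show "Ck k S (\<lambda>x. frechet_derivative g (at x) i)" using Suc.prems(2) i by simp
      show "Ck k T (\<lambda>x. frechet_derivative f (at x) b)" if "b \<in> Basis" for b
        using Suc.prems(1) that by simp
    qed
  qed
qed

lemma Ck_inverse_real: "Ck k {x::real. x \<noteq> 0} inverse"
proof (induction k)
  case 0
  show ?case by (auto intro!: continuous_intros)
next
  case (Suc k)
  have o: "open {x::real. x \<noteq> 0}" by (simp add: open_Collect_neq)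
  show ?case
  proof (rule Ck_SucI[OF o])
    show "(inverse has_derivative (\<lambda>h. - (inverse x * h * inverse x))) (at x)"
      if "x \<in> {x. x \<noteq> 0}" for x :: real
      using has_derivative_inverse'[of x] that by auto
    fix i :: real assume "i \<in> Basis"
    then have "i = 1" by (simp add: Basis_real_def)
    then show "Ck k {x. x \<noteq> 0} (\<lambda>x. - (inverse x * i * inverse x))"
      using Ck_bounded_linear_compose[OF o bounded_linear_minus[OF bounded_linear_ident]
          Ck_bilinear[OF o bounded_bilinear_mult Suc Suc]] by simp
  qed
qed

section \<open>Calculus of smooth functions\<close>

lemma smooth_on_cong: "open S \<Longrightarrow> smooth_on S f \<Longrightarrow> (\<And>x. x \<in> S \<Longrightarrow> f x = g x) \<Longrightarrow> smooth_on S g"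
  unfolding smooth_on_def by (rule allI, rule Ck_cong[of S f g]) auto

lemma smooth_on_subset: "smooth_on S f \<Longrightarrow> T \<subseteq> S \<Longrightarrow> smooth_on T f"
  unfolding smooth_on_def by (rule allI, rule Ck_subset) auto

lemma smooth_on_const: "open S \<Longrightarrow> smooth_on S (\<lambda>x. c)"
  unfolding smooth_on_def by (rule allI, rule Ck_const) auto

lemma smooth_on_ident: "open S \<Longrightarrow> smooth_on S (\<lambda>x. x)"
  unfolding smooth_on_def by (rule allI, rule Ck_ident) auto

lemma smooth_on_bounded_linear_compose:
  "open S \<Longrightarrow> bounded_linear L \<Longrightarrow> smooth_on S f \<Longrightarrow> smooth_on S (\<lambda>x. L (f x))"
  unfolding smooth_on_def by (rule allI, rule Ck_bounded_linear_compose) auto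

lemma smooth_on_bounded_linear: "open S \<Longrightarrow> bounded_linear L \<Longrightarrow> smooth_on S L"
  by (rule smooth_on_bounded_linear_compose[OF _ _ smooth_on_ident])

lemma smooth_on_add: "open S \<Longrightarrow> smooth_on S f \<Longrightarrow> smooth_on S g \<Longrightarrow> smooth_on S (\<lambda>x. f x + g x)"
  unfolding smooth_on_def by (rule allI, rule Ck_add) auto

lemma smooth_on_uminus: "open S \<Longrightarrow> smooth_on S f \<Longrightarrow> smooth_on S (\<lambda>x. - f x)"
  by (rule smooth_on_bounded_linear_compose[OF _ bounded_linear_minus[OF bounded_linear_ident]])

lemma smooth_on_diff: "open S \<Longrightarrow> smooth_on S f \<Longrightarrow> smooth_on S g \<Longrightarrow> smooth_on S (\<lambda>x. f x - g x)"
  using smooth_on_add[OF _ _ smooth_on_uminus, of S f g] by simp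

lemma smooth_on_sum:
  "open S \<Longrightarrow> (\<And>i. i \<in> I \<Longrightarrow> smooth_on S (f i)) \<Longrightarrow> smooth_on S (\<lambda>x. \<Sum>i\<in>I. f i x)"
  unfolding smooth_on_def by (rule allI, rule Ck_sum) auto

lemma smooth_on_scaleR:
  "open S \<Longrightarrow> smooth_on S f \<Longrightarrow> smooth_on S g \<Longrightarrow> smooth_on S (\<lambda>x. f x *\<^sub>R g x)"
  unfolding smooth_on_def by (rule allI, rule Ck_bilinear[OF _ bounded_bilinear_scaleR]) auto

lemma smooth_on_mult:
  fixes f g :: "'a::euclidean_space \<Rightarrow> real"
  shows "open S \<Longrightarrow> smooth_on S f \<Longrightarrow> smooth_on S g \<Longrightarrow> smooth_on S (\<lambda>x. f x * g x)"
  using smooth_on_scaleR[of S f g] by simp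

lemma smooth_on_power:
  fixes f :: "'a::euclidean_space \<Rightarrow> real"
  shows "open S \<Longrightarrow> smooth_on S f \<Longrightarrow> smooth_on S (\<lambda>x. f x ^ n)"
  by (induction n) (simp_all add: smooth_on_const smooth_on_mult)

lemma smooth_on_compose:
  fixes g :: "'a::euclidean_space \<Rightarrow> 'b::euclidean_space" and f :: "'b \<Rightarrow> 'c::real_normed_vector"
  assumes "open S" "open T" "g ` S \<subseteq> T" "smooth_on T f" "smooth_on S g"
  shows "smooth_on S (\<lambda>x. f (g x))"
  unfolding smooth_on_def
proof
  fix k show "Ck k S (\<lambda>x. f (g x))"
    by (rule Ck_compose[OF assms(1-3)]) (use assms(4,5) in \<open>simp_all add: smooth_on_def\<close>)
qed

lemma smooth_on_inverse:
  fixes f :: "'a::euclidean_space \<Rightarrow> real"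
  assumes "open S" "smooth_on S f" "\<And>x. x \<in> S \<Longrightarrow> f x \<noteq> 0"
  shows "smooth_on S (\<lambda>x. inverse (f x))"
proof (rule smooth_on_compose[OF assms(1) _ _ _ assms(2)])
  show "open {x::real. x \<noteq> 0}" by (simp add: open_Collect_neq)
  show "f ` S \<subseteq> {x. x \<noteq> 0}" using assms(3) by auto
  show "smooth_on {x::real. x \<noteq> 0} inverse" unfolding smooth_on_def using Ck_inverse_real by simp
qed

lemma smooth_on_divide:
  fixes f g :: "'a::euclidean_space \<Rightarrow> real"
  assumes "open S" "smooth_on S f" "smooth_on S g" "\<And>x. x \<in> S \<Longrightarrow> g x \<noteq> 0"
  shows "smooth_on S (\<lambda>x. f x / g x)"
  using smooth_on_mult[OF assms(1,2) smooth_on_inverse[OF assms(1,3)]] assms(4)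
  by (simp add: divide_inverse)

lemma smooth_on_componentwise:
  fixes f :: "'a::euclidean_space \<Rightarrow> 'b::euclidean_space"
  assumes "open S" "\<And>b. b \<in> Basis \<Longrightarrow> smooth_on S (\<lambda>x. f x \<bullet> b)"
  shows "smooth_on S f"
  unfolding smooth_on_def
proof
  show "Ck k S f" for k
    by (rule Ck_componentwise[OF assms(1)]) (use assms(2) in \<open>simp add: smooth_on_def\<close>)
qed

lemma smooth_on_vec:
  fixes f :: "'a::euclidean_space \<Rightarrow> real^'n"
  assumes "open S" "\<And>i. smooth_on S (\<lambda>x. f x $ i)"
  shows "smooth_on S f"
  by (rule smooth_on_componentwise[OF assms(1)])
    (use assms(2) in \<open>auto simp: Basis_vec_def inner_axis\<close>)

lemma smooth_on_vec_nth:
  fixes f :: "'a::euclidean_space \<Rightarrow> real^'n"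
  shows "open S \<Longrightarrow> smooth_on S f \<Longrightarrow> smooth_on S (\<lambda>x. f x $ i)"
  by (rule smooth_on_bounded_linear_compose[OF _ bounded_linear_vec_nth])

lemma smooth_on_Pair:
  fixes f :: "'a::euclidean_space \<Rightarrow> 'b::euclidean_space" and g :: "'a \<Rightarrow> 'c::euclidean_space"
  assumes "open S" "smooth_on S f" "smooth_on S g"
  shows "smooth_on S (\<lambda>x. (f x, g x))"
proof -
  have "smooth_on S (\<lambda>x. (f x, 0) + (0, g x))"
    by (intro smooth_on_add smooth_on_bounded_linear_compose[where f = f and L = "\<lambda>y. (y, 0)"]
        smooth_on_bounded_linear_compose[where f = g and L = "\<lambda>y. (0, y)"] assms
        bounded_linear_Pair bounded_linear_ident bounded_linear_zero)
  then show ?thesis by simp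
qed

lemma smooth_on_frechet_derivative:
  fixes f :: "'a::euclidean_space \<Rightarrow> 'b::real_normed_vector"
  assumes "open S" "smooth_on S f"
  shows "smooth_on S (\<lambda>x. frechet_derivative f (at x) w)"
proof -
  have lin: "linear (frechet_derivative f (at x))" if "x \<in> S" for x
    using assms(2) that linear_frechet_derivative unfolding smooth_on_def by (metis Ck.simps(2))
  have "smooth_on S (\<lambda>x. \<Sum>b\<in>Basis. (w \<bullet> b) *\<^sub>R frechet_derivative f (at x) b)"
  proof (intro smooth_on_sum smooth_on_bounded_linear_compose[OF _ bounded_linear_scaleR_right] assms)
    show "smooth_on S (\<lambda>x. frechet_derivative f (at x) b)" if "b \<in> Basis" for b
      unfolding smooth_on_def
    proof
      fix k
      have "Ck (Suc k) S f" using assms(2) smooth_on_def by blast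
      then show "Ck k S (\<lambda>x. frechet_derivative f (at x) b)" using that by simp
    qed
  qed
  moreover have "(\<Sum>b\<in>Basis. (w \<bullet> b) *\<^sub>R frechet_derivative f (at x) b) = frechet_derivative f (at x) w"
    if "x \<in> S" for x
    by (subst (3) euclidean_representation[symmetric]) (simp add: linear_sum linear_cmul lin[OF that])
  ultimately show ?thesis by (rule smooth_on_cong[OF assms(1)])
qed

lemma smooth_on_has_derivative:
  "smooth_on S f \<Longrightarrow> x \<in> S \<Longrightarrow> (f has_derivative frechet_derivative f (at x)) (at x)"
  unfolding smooth_on_def using Ck_SucD_derivative by blast

lemma smooth_on_imp_continuous_on: "smooth_on S f \<Longrightarrow> continuous_on S f"
  unfolding smooth_on_def using Ck.simps(1) by blast

lemma smooth_on_has_field_derivative: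
  fixes f :: "real \<Rightarrow> real"
  assumes "smooth_on S f" "x \<in> S"
  shows "(f has_field_derivative deriv f x) (at x)"
proof -
  have "f differentiable (at x)" using smooth_on_has_derivative[OF assms] by (auto simp: differentiable_def)
  then show ?thesis by (metis DERIV_deriv_iff_real_differentiable)
qed

lemma smooth_on_deriv:
  fixes f :: "real \<Rightarrow> real"
  assumes "open S" "smooth_on S f"
  shows "smooth_on S (deriv f)"
proof (rule smooth_on_cong[OF assms(1) smooth_on_frechet_derivative[OF assms, of 1]])
  fix x assume "x \<in> S"
  from frechet_derivative_at[OF smooth_on_has_field_derivative[OF assms(2) this, unfolded has_field_derivative_def]]
  show "frechet_derivative f (at x) 1 = deriv f x" by (metis mult.right_neutral)
qed

lemma smooth_on_antiderivative:
  fixes f :: "real \<Rightarrow> real"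
  assumes "open S" "smooth_on S f'" "\<And>x. x \<in> S \<Longrightarrow> (f has_field_derivative f' x) (at x)"
  shows "smooth_on S f"
  unfolding smooth_on_def
proof
  fix k
  have "Ck (Suc k) S f"
    by (rule Ck_SucI[OF assms(1) assms(3)[unfolded has_field_derivative_def]])
      (use assms(2) in \<open>auto simp: smooth_on_def Basis_real_def\<close>)
  then show "Ck k S f" by (rule Ck_SucD)
qed

text \<open>Serves for functions that are constructed together with all their derivatives, by
  integrals depending on a parameter or by pasting. The induction on k runs over all n at
  once.\<close>

lemma smooth_on_derivative_seq:
  fixes F :: "nat \<Rightarrow> real \<Rightarrow> real"
  assumes "open S" "\<And>n x. x \<in> S \<Longrightarrow> (F n has_field_derivative F (Suc n) x) (at x)"
  shows "smooth_on S (F n)"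
  unfolding smooth_on_def
proof
  fix k show "Ck k S (F n)"
  proof (induction k arbitrary: n)
    case 0
    then show ?case using assms(2)
      by (auto intro!: continuous_at_imp_continuous_on DERIV_isCont)
  next
    case (Suc k)
    show ?case
      by (rule Ck_SucI[OF assms(1) assms(2)[unfolded has_field_derivative_def]])
        (use Suc.IH in \<open>auto simp: Basis_real_def\<close>)
  qed
qed

text \<open>The inverse function theorem yields a differentiable inverse g with g' y = inv (D (g
  y)). Smoothness is bootstrapped: by Cramer's rule g' is rational in the entries of D (g y), so if
  g is of class k, then g' is of class k and g of class k + 1.\<close>

theorem local_diffeo_at_if_det_neq_0:
  fixes f :: "real^'n \<Rightarrow> real^'n"
  assumes "open S" "smooth_on S f" "x0 \<in> S" "det (matrix (frechet_derivative f (at x0))) \<noteq> 0"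
  shows "local_diffeo_at f x0"
proof -
  define D where "D = (\<lambda>x. frechet_derivative f (at x))"
  have D: "(f has_derivative D x) (at x)" if "x \<in> S" for x
    unfolding D_def using smooth_on_has_derivative[OF assms(2) that] .
  have DL: "bounded_linear (D x)" "linear (D x)" if "x \<in> S" for x
    using D[OF that] has_derivative_bounded_linear has_derivative_linear by auto
  have Dsm: "smooth_on S (\<lambda>x. D x w)" for w
    unfolding D_def by (rule smooth_on_frechet_derivative[OF assms(1,2)])
  have Dc: "continuous_on S (\<lambda>x. Blinfun (D x))"
    by (rule continuous_on_blinfun_componentwise)
      (use smooth_on_imp_continuous_on[OF Dsm] DL in
        \<open>auto simp: bounded_linear_Blinfun_apply cong: continuous_on_cong\<close>)
  have "invertible (matrix (D x0))" using assms(4) by (simp add: D_def invertible_det_nz)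
  then obtain B where B: "B ** matrix (D x0) = mat 1" unfolding invertible_def by blast
  have "Blinfun ((*v) B) o\<^sub>L Blinfun (D x0) = id_blinfun"
  proof (rule blinfun_eqI)
    fix x
    have "B *v (D x0 x) = B *v (matrix (D x0) *v x)"
      by (simp add: matrix_works DL assms(3))
    also have "\<dots> = x" by (simp add: matrix_vector_mul_assoc B)
    finally show "(Blinfun ((*v) B) o\<^sub>L Blinfun (D x0)) x = id_blinfun x"
      by (simp add: bounded_linear_Blinfun_apply DL assms(3) matrix_vector_mul_bounded_linear)
  qed
  moreover have "(f has_derivative blinfun_apply (Blinfun (D x))) (at x)" if "x \<in> S" for x
    using D DL that by (simp add: bounded_linear_Blinfun_apply)
  ultimately obtain U V g g' where UV: "open U" "U \<subseteq> S" "x0 \<in> U" "open V" "f x0 \<in> V"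
    "homeomorphism U V f g"
    and g': "\<And>y. y \<in> V \<Longrightarrow> (g has_derivative g' y) (at y)"
      "\<And>y. y \<in> V \<Longrightarrow> g' y = inv (blinfun_apply (Blinfun (D (g y))))"
      "\<And>y. y \<in> V \<Longrightarrow> bij (blinfun_apply (Blinfun (D (g y))))"
    using inverse_function_theorem[OF assms(1) _ Dc assms(3)] by metis
  have gV: "g ` V = U" "f ` U = V" "\<And>x. x \<in> U \<Longrightarrow> g (f x) = x" "\<And>y. y \<in> V \<Longrightarrow> f (g y) = y"
    using UV(6) unfolding homeomorphism_def by auto
  have gS: "g y \<in> S" if "y \<in> V" for y using gV UV that by auto
  define M where "M = (\<lambda>y. matrix (D (g y)))"
  have bij: "bij (D (g y))" and inv: "g' y = inv (D (g y))" if "y \<in> V" for y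
    using g'(2,3)[OF that] gS[OF that] DL by (simp_all add: bounded_linear_Blinfun_apply)
  have M: "det (M y) \<noteq> 0" if "y \<in> V" for y
  proof -
    have "invertible (M y)"
      unfolding M_def using bij[OF that] DL(2)[OF gS[OF that]]
      by (metis invertible_eq_bij matrix_vector_mul)
    then show ?thesis by (simp add: invertible_det_nz)
  qed
  \<comment> \<open>Cramer's formula for the solution of \<open>M y *v x = w\<close>: column k of
    the matrix is replaced by w.\<close>
  define N where "N = (\<lambda>w y. \<chi> k. det (\<chi> i j. if j = k then w $ i else M y $ i $ j) / det (M y))"
  have g'N: "g' y w = N w y" if "y \<in> V" for y w
  proof -
    have "D (g y) (g' y w) = w" using bij[OF that] inv[OF that] by (simp add: bij_is_surj surj_f_inv_f)
    then have "M y *v g' y w = w" unfolding M_def using DL(2)[OF gS[OF that]] by (simp add: matrix_works)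
    then show ?thesis using cramer[OF M[OF that]] unfolding N_def by blast
  qed
  have "Ck k V g" for k
  proof (induction k)
    case 0
    show ?case using UV(6) by (simp add: homeomorphism_def)
  next
    case (Suc k)
    have ent: "Ck k V (\<lambda>y. M y $ i $ j)" for i j
    proof -
      have "Ck k V (\<lambda>y. D (g y) (axis j 1) $ i)"
        using Dsm gS
        by (intro Ck_bounded_linear_compose[OF UV(4) bounded_linear_vec_nth]
            Ck_compose[OF UV(4) assms(1) _ _ Suc, where f = "\<lambda>x. D x (axis j 1)"])
          (auto simp: smooth_on_def)
      then show ?thesis by (simp add: M_def matrix_def)
    qed
    have det: "Ck k V (\<lambda>y. det (A y))" if "\<And>i j. Ck k V (\<lambda>y. A y $ i $ j)" for A :: "_ \<Rightarrow> real^'n^'n"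
      unfolding det_def
      by (intro Ck_sum UV(4) Ck_bilinear[OF _ bounded_bilinear_mult] Ck_const Ck_prod that)
    have Ninv: "Ck k V (\<lambda>y. inverse (det (M y)))"
      by (rule Ck_compose[OF UV(4) _ _ Ck_inverse_real det[OF ent]])
        (use M in \<open>auto simp: open_Collect_neq\<close>)
    have entN: "Ck k V (\<lambda>y. (\<chi> i j. if j = m then w $ i else M y $ i $ j) $ i $ j)" for m i j and w :: "real^'n"
      by (cases "j = m") (simp_all add: Ck_const UV(4) ent)
    have NC: "Ck k V (N w)" for w
    proof (rule Ck_componentwise[OF UV(4)])
      fix b :: "real^'n" assume "b \<in> Basis"
      then obtain m where b: "b = axis m 1" by (auto simp: Basis_vec_def)
      show "Ck k V (\<lambda>y. N w y \<bullet> b)"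
        using Ck_bilinear[OF UV(4) bounded_bilinear_mult det[OF entN[of m w]] Ninv]
        by (simp add: b N_def inner_axis divide_inverse)
    qed
    show ?case
      by (rule Ck_SucI[OF UV(4) g'(1)]) (use g'N Ck_cong[OF UV(4) _ NC] in auto)
  qed
  then show ?thesis
    unfolding local_diffeo_at_def using UV gV smooth_on_subset[OF assms(2) UV(2)]
    by (intro exI[of _ U] exI[of _ V] exI[of _ g]) (auto simp: smooth_on_def)
qed

lemma local_diffeo_at_inverse:
  assumes "local_diffeo_at f x"
  obtains U V g where "open U" "x \<in> U" "open V" "f x \<in> V" "f ` U = V" "\<And>y. y \<in> U \<Longrightarrow> g (f y) = y"
    "local_diffeo_at g (f x)"
proof -
  from assms obtain U V g where *: "open U" "x \<in> U" "open V" "f ` U = V" "smooth_on U f" "smooth_on V g"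
    "\<And>y. y \<in> U \<Longrightarrow> g (f y) = y" "\<And>z. z \<in> V \<Longrightarrow> f (g z) = z"
    unfolding local_diffeo_at_def by blast
  have "local_diffeo_at g (f x)"
    unfolding local_diffeo_at_def
    by (rule exI[of _ V], rule exI[of _ U], rule exI[of _ f]) (use * in \<open>auto simp: image_iff\<close>)
  with * show ?thesis by (intro that[of U V g]) auto
qed

section \<open>Theorems of Borel, Hadamard and Whitney\<close>

lemma smooth_on_higher_deriv:
  fixes f :: "real \<Rightarrow> real"
  assumes "open S" "smooth_on S f"
  shows "smooth_on S ((deriv ^^ n) f)"
  by (induction n) (simp_all add: assms smooth_on_deriv)

lemma smooth_on_has_higher_deriv:
  fixes f :: "real \<Rightarrow> real"
  assumes "open S" "smooth_on S f" "x \<in> S"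
  shows "((deriv ^^ n) f has_field_derivative (deriv ^^ Suc n) f x) (at x)"
  using smooth_on_has_field_derivative[OF smooth_on_higher_deriv[OF assms(1,2)] assms(3)] by simp

lemma higher_deriv_cong:
  fixes f g :: "real \<Rightarrow> real"
  assumes "open S" "\<And>x. x \<in> S \<Longrightarrow> f x = g x" "x \<in> S"
  shows "(deriv ^^ n) f x = (deriv ^^ n) g x"
  using assms(3)
proof (induction n arbitrary: x)
  case (Suc n)
  have "\<forall>\<^sub>F y in nhds x. (deriv ^^ n) f y = (deriv ^^ n) g y"
    using eventually_nhds_in_open[OF assms(1) Suc.prems] by eventually_elim (rule Suc.IH)
  then show ?case by (simp add: deriv_cong_ev)
qed (simp add: assms(2))

text \<open>The k-th derivative of sin^i cos^j. The truncated subtractions are harmless, because the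
  factor \<open>real i\<close> or \<open>real j\<close> is 0 whenever they truncate. Powers of sin
  replace the cutoff functions usual in Borel's lemma: all their derivatives are bounded on the
  whole line, and sin^m vanishes at 0 to order exactly m.\<close>

primrec sin_cos_deriv :: "nat \<Rightarrow> nat \<Rightarrow> nat \<Rightarrow> real \<Rightarrow> real" where
  "sin_cos_deriv 0 i j y = sin y ^ i * cos y ^ j"
| "sin_cos_deriv (Suc k) i j y =
    real i * sin_cos_deriv k (i - 1) (j + 1) y - real j * sin_cos_deriv k (i + 1) (j - 1) y"

lemma has_field_derivative_sin_cos_deriv:
  "(sin_cos_deriv k i j has_field_derivative sin_cos_deriv (Suc k) i j y) (at y)"
proof (induction k arbitrary: i j)
  case 0
  show ?case by (auto intro!: derivative_eq_intros)
next
  case (Suc k)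
  have eq: "sin_cos_deriv (Suc k) i j =
    (\<lambda>y. real i * sin_cos_deriv k (i - 1) (j + 1) y - real j * sin_cos_deriv k (i + 1) (j - 1) y)"
    by (rule ext) (simp only: sin_cos_deriv.simps)
  show ?case
    unfolding eq by (subst sin_cos_deriv.simps(2)) (intro DERIV_diff DERIV_cmult Suc.IH)
qed

text \<open>The recursion preserves i + j and its two coefficients add up to i + j, so every
  derivative costs one factor i + j.\<close>

lemma abs_sin_cos_deriv_le: "\<bar>sin_cos_deriv k i j y\<bar> \<le> real (i + j) ^ k"
proof (induction k arbitrary: i j)
  case 0
  have "\<bar>sin y\<bar> ^ i * \<bar>cos y\<bar> ^ j \<le> 1 * 1"
    by (intro mult_mono power_le_one) auto
  then show ?case by (simp add: abs_mult power_abs)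
next
  case (Suc k)
  have 1: "\<bar>real i * sin_cos_deriv k (i - 1) (j + 1) y\<bar> \<le> real i * real (i + j) ^ k"
    using Suc.IH[of "i - 1" "j + 1"] by (cases "i = 0") (auto simp: abs_mult intro: mult_left_mono)
  have 2: "\<bar>real j * sin_cos_deriv k (i + 1) (j - 1) y\<bar> \<le> real j * real (i + j) ^ k"
    using Suc.IH[of "i + 1" "j - 1"] by (cases "j = 0") (auto simp: abs_mult intro: mult_left_mono)
  have "real i * real (i + j) ^ k + real j * real (i + j) ^ k = real (i + j) ^ Suc k"
    by (simp add: algebra_simps)
  with 1 2 show ?case unfolding sin_cos_deriv.simps by linarith
qed

lemma sin_cos_deriv_0: "k < i \<Longrightarrow> sin_cos_deriv k i j 0 = 0"
  by (induction k arbitrary: i j) auto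

lemma sin_cos_deriv_same: "sin_cos_deriv i i j 0 = fact i"
  by (induction i arbitrary: j) (auto simp: sin_cos_deriv_0)

text \<open>The $k$-th derivative of $c\,(\sin (t y) / t)^m$, where $t$ is chosen so large that the
  derivatives of order $k < m$ are at most $2^{-m}$.\<close>

definition borel_term :: "real \<Rightarrow> nat \<Rightarrow> nat \<Rightarrow> real \<Rightarrow> real" where
  "borel_term c m k y = (let t = 1 + \<bar>c\<bar> * (2 * real m) ^ m in
     c * t ^ k / t ^ m * sin_cos_deriv k m 0 (t * y))"

lemma has_field_derivative_borel_term:
  "(borel_term c m k has_field_derivative borel_term c m (Suc k) y) (at y)"
  unfolding borel_term_def Let_def
  by (rule derivative_eq_intros refl DERIV_chain2[OF has_field_derivative_sin_cos_deriv])+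
    (simp del: sin_cos_deriv.simps)

lemma abs_borel_term_le:
  assumes "k < m"
  shows "\<bar>borel_term c m k y\<bar> \<le> (1 / 2) ^ m"
proof -
  define t where "t = 1 + \<bar>c\<bar> * (2 * real m) ^ m"
  have t: "t \<ge> 1" by (simp add: t_def)
  have "\<bar>borel_term c m k y\<bar> = \<bar>c\<bar> * t ^ k / t ^ m * \<bar>sin_cos_deriv k m 0 (t * y)\<bar>"
    unfolding borel_term_def t_def[symmetric] Let_def using t by (simp add: abs_mult)
  also have "\<dots> \<le> \<bar>c\<bar> * t ^ k / t ^ m * real m ^ k"
    using abs_sin_cos_deriv_le[of k m 0] t by (intro mult_left_mono) auto
  also have "\<dots> \<le> \<bar>c\<bar> * t ^ k / t ^ m * real m ^ m"
    using assms t by (intro mult_left_mono power_increasing) auto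
  \<comment> \<open>As t \<ge> 1 and k < m, the power t^m may be lowered to t^(k+1). One factor t is
    left in the denominator, and t was chosen to dominate |c| (2m)^m.\<close>
  also have "\<dots> \<le> \<bar>c\<bar> * t ^ k / t ^ Suc k * real m ^ m"
    using assms t by (intro mult_right_mono divide_left_mono power_increasing) auto
  also have "\<dots> = \<bar>c\<bar> * real m ^ m / t" using t by simp
  also have "\<dots> \<le> (1 / 2) ^ m"
  proof -
    have "\<bar>c\<bar> * (2 * real m) ^ m \<le> t" by (simp add: t_def)
    then have "\<bar>c\<bar> * real m ^ m * 2 ^ m \<le> t" by (simp add: power_mult_distrib mult_ac)
    then show ?thesis using t by (simp add: divide_simps power_divide)
  qed
  finally show ?thesis .
qed

text \<open>The system for the coefficients is triangular: the term of index n contributes its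
  coefficient times n! to the n-th derivative at 0, terms of larger index contribute nothing, and
  those of smaller index are already known.\<close>

function borel_coeff :: "(nat \<Rightarrow> real) \<Rightarrow> nat \<Rightarrow> real" where
  "borel_coeff a n = (a n - (\<Sum>m<n. borel_term (borel_coeff a m) m n 0)) / fact n"
  by pat_completeness auto
termination by lexicographic_order

declare borel_coeff.simps [simp del]

text \<open>For the k-th derivatives, all terms with m > k are at most 2^(-m), so the series may be
  differentiated termwise as often as desired. \<open>B\<close> lists the function with all its
  derivatives, which is the form needed for pasting in \<open>whitney_even\<close>.\<close>

theorem borel_lemma:
  fixes a :: "nat \<Rightarrow> real"
  obtains B where "\<And>n y. (B n has_field_derivative B (Suc n) y) (at y)" "\<And>n. B n 0 = a n"
proof
  define b where "b = (\<lambda>k m y. borel_term (borel_coeff a m) m k y)"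
  have bnd: "\<forall>\<^sub>F m in sequentially. \<forall>y\<in>UNIV. norm (b k m y) \<le> (1 / 2) ^ m" for k
    using eventually_gt_at_top[of k] by eventually_elim (simp add: b_def abs_borel_term_le)
  have unif: "uniformly_convergent_on UNIV (\<lambda>n y. \<Sum>i<n. b k i y)" for k
    by (rule Weierstrass_m_test'_ev[OF bnd]) (simp add: summable_geometric)
  have zero: "b k m 0 = 0" if "k < m" for k m
    using that by (simp add: b_def borel_term_def Let_def sin_cos_deriv_0)
  have smm: "summable (\<lambda>m. b k m 0)" for k
    by (rule summable_finite[of "{..k}"]) (auto simp: zero)
  show "((\<lambda>y. \<Sum>m. b n m y) has_field_derivative (\<Sum>m. b (Suc n) m y)) (at y)" for n y
  proof -
    have "(b n m has_field_derivative b (Suc n) m x) (at x)" for m x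
      using has_field_derivative_borel_term unfolding b_def .
    from has_field_derivative_series'(2)[of UNIV "b n" "b (Suc n)" 0 y, OF convex_UNIV this unif _ smm]
    show ?thesis by simp
  qed
  show "(\<Sum>m. b n m 0) = a n" for n
  proof -
    have "(\<Sum>m. b n m 0) = (\<Sum>m\<le>n. b n m 0)"
      by (rule suminf_finite) (auto simp: zero)
    \<comment> \<open>The term of index n is c t^n / t^n n!; cancelling needs t = 1 + |c| (2n)^n to
      be nonzero.\<close>
    also have "\<dots> = (\<Sum>m<n. b n m 0) + borel_coeff a n * fact n"
      by (simp add: lessThan_Suc_atMost[symmetric] b_def borel_term_def Let_def sin_cos_deriv_same)
        (metis abs_ge_zero add_nonneg_eq_0_iff mult_nonneg_nonneg of_nat_0_le_iff zero_le_mult_iff zero_le_numeral zero_le_one zero_le_power zero_neq_one)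
    also have "\<dots> = a n" by (subst borel_coeff.simps) (simp add: b_def)
    finally show ?thesis .
  qed
qed

text \<open>The quotient is q(s) = integral of f'(t s) over t in [0, 1]. In this form it is visibly
  smooth at s = 0 as well.\<close>

theorem hadamard_lemma:
  fixes f :: "real \<Rightarrow> real"
  assumes "smooth_on {-d<..<d} f"
  obtains q where "smooth_on {-d<..<d} q" "\<And>s. s \<in> {-d<..<d} \<Longrightarrow> f s = f 0 + s * q s"
proof
  define S where "S = {-d<..<d}"
  \<comment> \<open>\<open>q k\<close> is the k-th derivative of the quotient, found by
    differentiating k times under the integral sign.\<close>
  define q where "q = (\<lambda>k s. integral (cbox 0 1) (\<lambda>t. t ^ k * (deriv ^^ Suc k) f (t * s)))"
  have S: "open S" "convex S" by (simp_all add: S_def)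
  note f = smooth_on_has_higher_deriv[OF S(1) assms[folded S_def]]
  have ts: "t * s \<in> S" if "s \<in> S" "t \<in> cbox 0 1" for s t :: real
  proof -
    have "\<bar>t * s\<bar> \<le> 1 * \<bar>s\<bar>" unfolding abs_mult using that by (intro mult_right_mono) auto
    then show ?thesis using that by (auto simp: S_def)
  qed
  have cont: "continuous_on A (\<lambda>x. (deriv ^^ k) f (h x))" if "continuous_on A h" "h ` A \<subseteq> S"
    for A :: "'a::topological_space set" and h k
    using smooth_on_imp_continuous_on[OF smooth_on_higher_deriv[OF S(1) assms[folded S_def]]] that
    by (rule continuous_on_compose2)
  have "(q k has_field_derivative q (Suc k) s) (at s)" if s: "s \<in> S" for k s
  proof -
    have "(q k has_field_derivative q (Suc k) s) (at s within S)"
      unfolding q_def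
    proof (rule leibniz_rule_field_derivative[OF _ _ _ s S(2)])
      fix x t :: real assume xt: "x \<in> S" "t \<in> cbox 0 1"
      have "((\<lambda>x. t ^ k * (deriv ^^ Suc k) f (t * x)) has_field_derivative
          t ^ k * ((deriv ^^ Suc (Suc k)) f (t * x) * t)) (at x)"
        by (intro DERIV_cmult DERIV_chain2[where g = "\<lambda>x. t * x"] f ts xt)
          (auto intro!: derivative_eq_intros)
      then show "((\<lambda>x. t ^ k * (deriv ^^ Suc k) f (t * x)) has_field_derivative
          t ^ Suc k * (deriv ^^ Suc (Suc k)) f (t * x)) (at x within S)"
        by (auto intro!: has_field_derivative_at_within elim!: DERIV_cong simp del: funpow.simps)
    next
      fix x assume "x \<in> S"
      then show "(\<lambda>t. t ^ k * (deriv ^^ Suc k) f (t * x)) integrable_on cbox 0 1"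
        using ts
        by (intro integrable_continuous continuous_on_mult[OF _ cont[of _ "\<lambda>t. t * x"]])
          (auto intro: continuous_on_power continuous_on_id continuous_on_mult_right simp del: funpow.simps)
    next
      show "continuous_on (S \<times> cbox 0 1) (\<lambda>(x, t). t ^ Suc k * (deriv ^^ Suc (Suc k)) f (t * x))"
        unfolding case_prod_beta using ts
        by (intro continuous_on_mult[OF _ cont[of _ "\<lambda>z. snd z * fst z"]])
          (auto intro!: continuous_on_mult continuous_on_power continuous_on_fst continuous_on_snd
            continuous_on_id simp del: funpow.simps)
    qed
    then show ?thesis using at_within_open[OF s S(1)] by simp
  qed
  then show "smooth_on {-d<..<d} (q 0)"
    using smooth_on_derivative_seq[OF S(1), of q] by (simp add: S_def)
  fix s assume s: "s \<in> {-d<..<d}"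
  have "((\<lambda>t. (deriv ^^ Suc 0) f (t * s) * s) has_integral f (1 * s) - f (0 * s)) {0..1}"
  proof (rule fundamental_theorem_of_calculus)
    fix t :: real assume "t \<in> {0..1}"
    then have "((\<lambda>t. (deriv ^^ 0) f (t * s)) has_field_derivative (deriv ^^ Suc 0) f (t * s) * s) (at t)"
      using s by (intro DERIV_chain2[where g = "\<lambda>t. t * s"] f ts)
        (auto simp: S_def intro!: derivative_eq_intros)
    then show "((\<lambda>t. f (t * s)) has_vector_derivative (deriv ^^ Suc 0) f (t * s) * s) (at t within {0..1})"
      by (simp add: has_real_derivative_iff_has_vector_derivative has_vector_derivative_at_within)
  qed simp
  then have "integral {0..1} (\<lambda>t. (deriv ^^ Suc 0) f (t * s) * s) = f (1 * s) - f (0 * s)"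
    by (rule integral_unique)
  then show "f s = f 0 + s * q 0 s" by (simp add: q_def algebra_simps)
qed

text \<open>For $y \<ge> 0$ the $k$-th derivative of the function $E$ with
  $f(s) = E(s^2)$ is $\varphi_k(\sqrt y)$ where $\varphi_{k+1}(s) = \varphi_k'(s) / (2s)$; Borel's
  lemma supplies an extension to $y < 0$.\<close>

theorem whitney_even:
  fixes f :: "real \<Rightarrow> real"
  assumes "d > 0" "smooth_on {-d<..<d} f" "\<And>s. s \<in> {-d<..<d} \<Longrightarrow> f (- s) = f s"
  obtains E where "smooth_on {..<d\<^sup>2} E" "\<And>s. s \<in> {-d<..<d} \<Longrightarrow> f s = E (s\<^sup>2)"
proof -
  define S where "S = {-d<..<d}"
  have S: "open S" "0 \<in> S" "\<And>s. s \<in> S \<Longrightarrow> - s \<in> S" using assms(1) by (auto simp: S_def)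
  define P where "P = (\<lambda>\<phi>::real \<Rightarrow> real. smooth_on S \<phi> \<and> (\<forall>s\<in>S. \<phi> (- s) = \<phi> s))"
  \<comment> \<open>The derivative of an even function is odd, hence vanishes at 0 and has the form
    s q(s) with q even by Hadamard's lemma; the witness is q / 2.\<close>
  have "\<exists>\<psi>. P \<psi> \<and> (\<forall>s\<in>S. deriv \<phi> s = 2 * s * \<psi> s)" if "P \<phi>" for \<phi>
  proof -
    have sm: "smooth_on S \<phi>" and ev: "\<And>s. s \<in> S \<Longrightarrow> \<phi> (- s) = \<phi> s" using that by (auto simp: P_def)
    have odd: "deriv \<phi> (- s) = - deriv \<phi> s" if s: "s \<in> S" for s
    proof -
      have "((\<lambda>x. \<phi> (- x)) has_field_derivative deriv \<phi> (- s) * - 1) (at s)"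
        by (rule DERIV_chain2[where g = uminus])
          (auto intro!: derivative_eq_intros smooth_on_has_field_derivative[OF sm] S(3) s)
      then have "(\<phi> has_field_derivative deriv \<phi> (- s) * - 1) (at s)"
        by (rule has_field_derivative_transform_within_open[OF _ S(1) s]) (simp add: ev)
      then show ?thesis using DERIV_imp_deriv by fastforce
    qed
    obtain q where q: "smooth_on S q" "\<And>s. s \<in> S \<Longrightarrow> deriv \<phi> s = deriv \<phi> 0 + s * q s"
      using hadamard_lemma[OF smooth_on_deriv[OF S(1) sm, unfolded S_def]] unfolding S_def by metis
    have q': "deriv \<phi> s = s * q s" if "s \<in> S" for s
      using q(2)[OF that] odd[OF S(2)] by simp
    have "q (- s) = q s" if "s \<in> S" for s
      using odd[OF that] q'[OF that] q'[OF S(3)[OF that]] by (cases "s = 0") auto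
    then show ?thesis
      using q(1) q' smooth_on_mult[OF S(1) smooth_on_const[OF S(1), of "1/2"] q(1)]
      by (intro exI[of _ "\<lambda>s. 1/2 * q s"]) (auto simp: P_def)
  qed
  moreover have "P f" using assms by (auto simp: P_def S_def)
  ultimately obtain \<phi> where \<phi>: "\<phi> 0 = f" "\<And>k. P (\<phi> k)"
      "\<And>k s. s \<in> S \<Longrightarrow> deriv (\<phi> k) s = 2 * s * \<phi> (Suc k) s"
    using dependent_nat_choice[of "\<lambda>n \<phi>. P \<phi> \<and> (n = 0 \<longrightarrow> \<phi> = f)" "\<lambda>_ \<phi> \<psi>. \<forall>s\<in>S. deriv \<phi> s = 2 * s * \<psi> s"]
    by (metis nat.distinct(1))
  obtain B where B: "\<And>n y. (B n has_field_derivative B (Suc n) y) (at y)" "\<And>n. B n 0 = \<phi> n 0"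
    using borel_lemma[of "\<lambda>n. \<phi> n 0"] by blast
  \<comment> \<open>\<open>E k\<close> is to be the k-th derivative of \<open>E 0\<close>. The two
    branches fit at 0 because \<open>B k 0 = \<phi> k 0\<close> for every k.\<close>
  define E where "E = (\<lambda>k y. if y \<ge> 0 then \<phi> k (sqrt y) else B k y)"
  have sqS: "sqrt y \<in> S" if "0 \<le> y" "y < d\<^sup>2" for y
    using that assms(1) real_sqrt_less_mono[of y "d\<^sup>2"] real_sqrt_ge_zero[of y]
    unfolding S_def by (auto simp del: real_sqrt_ge_0_iff)
  have pos: "((\<lambda>y. \<phi> k (sqrt y)) has_field_derivative \<phi> (Suc k) (sqrt y)) (at y)"
    if "0 < y" "y < d\<^sup>2" for k y
  proof -
    have "((\<lambda>y. \<phi> k (sqrt y)) has_field_derivative deriv (\<phi> k) (sqrt y) * (inverse (sqrt y) / 2)) (at y)"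
      using \<phi>(2) sqS that
      by (intro DERIV_chain2[where g = sqrt] smooth_on_has_field_derivative[of S] DERIV_real_sqrt)
        (auto simp: P_def)
    then show ?thesis using \<phi>(3)[OF sqS] that by (simp add: field_simps)
  qed
  have cont0: "((\<lambda>y. \<phi> k (sqrt y)) \<longlongrightarrow> \<phi> k 0) (at_right 0)" for k
  proof -
    have "isCont (\<phi> k) 0"
      using \<phi>(2) S(2) by (auto simp: P_def intro: DERIV_isCont smooth_on_has_field_derivative)
    moreover have "((\<lambda>y. sqrt y) \<longlongrightarrow> 0) (at_right 0)"
      using tendsto_real_sqrt[OF tendsto_ident_at, of 0 "{0<..}"] by simp
    ultimately show ?thesis by (rule isCont_tendsto_compose)
  qed
  have "(E k has_field_derivative E (Suc k) y) (at y)" if y: "y \<in> {..<d\<^sup>2}" for k y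
  proof -
    consider "y > 0" | "y < 0" | "y = 0" by linarith
    then show ?thesis
    proof cases
      case 1
      then have "(E k has_field_derivative \<phi> (Suc k) (sqrt y)) (at y)"
        using y by (intro has_field_derivative_transform_within_open[OF pos, of y "{0<..}"]) (auto simp: E_def)
      then show ?thesis using 1 by (simp add: E_def)
    next
      case 2
      then have "(E k has_field_derivative B (Suc k) y) (at y)"
        by (intro has_field_derivative_transform_within_open[OF B(1), of "{..<0}"]) (auto simp: E_def)
      then show ?thesis using 2 by (simp add: E_def)
    next
      case 3
      have near: "\<forall>\<^sub>F h in at_right 0. 0 < h \<and> h < d\<^sup>2"
        using assms(1) by (intro eventually_at_rightI[of 0 "d\<^sup>2"]) auto
      \<comment> \<open>Since sqrt is not differentiable at 0, the right derivative comes from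
        l'Hopital's rule and the derivatives at h > 0.\<close>
      have "((\<lambda>h. (\<phi> k (sqrt h) - \<phi> k 0) / h) \<longlongrightarrow> E (Suc k) 0) (at_right 0)"
      proof (rule lhopital_right_0[where f' = "\<lambda>h. \<phi> (Suc k) (sqrt h)" and g' = "\<lambda>_. 1"])
        show "((\<lambda>h. \<phi> k (sqrt h) - \<phi> k 0) \<longlongrightarrow> 0) (at_right 0)"
          using tendsto_diff[OF cont0 tendsto_const, of k "\<phi> k 0"] by simp
        show "\<forall>\<^sub>F h in at_right 0. ((\<lambda>h. \<phi> k (sqrt h) - \<phi> k 0) has_field_derivative \<phi> (Suc k) (sqrt h)) (at h)"
          using near by eventually_elim (use pos in \<open>auto intro!: derivative_eq_intros\<close>)
        show "\<forall>\<^sub>F h in at_right 0. h \<noteq> (0::real)" using near by eventually_elim simp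
      qed (use cont0[of "Suc k"] in \<open>auto simp: E_def intro: tendsto_ident_at\<close>)
      have r: "((\<lambda>h. (E k h - E k 0) / h) \<longlongrightarrow> E (Suc k) 0) (at_right 0)"
      proof (rule Lim_transform_eventually[where f = "\<lambda>h. (\<phi> k (sqrt h) - \<phi> k 0) / h"])
        show "\<forall>\<^sub>F h in at_right 0. (\<phi> k (sqrt h) - \<phi> k 0) / h = (E k h - E k 0) / h"
          using near by eventually_elim (simp add: E_def)
      qed fact
      have "((\<lambda>h. (B k h - B k 0) / h) \<longlongrightarrow> B (Suc k) 0) (at_left 0)"
        using B(1)[of k 0] by (auto simp: has_field_derivative_iff filterlim_at_split)
      moreover have "\<forall>\<^sub>F h in at_left 0. (B k h - B k 0) / h = (E k h - E k 0) / h"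
        by (rule eventually_at_leftI[of "-1"]) (auto simp: E_def B(2))
      ultimately have l: "((\<lambda>h. (E k h - E k 0) / h) \<longlongrightarrow> E (Suc k) 0) (at_left 0)"
        using Lim_transform_eventually by (fastforce simp: E_def B(2))
      show ?thesis using l r 3 by (simp add: has_field_derivative_iff filterlim_at_split)
    qed
  qed
  then have "smooth_on {..<d\<^sup>2} (E 0)" by (intro smooth_on_derivative_seq) auto
  moreover have "f s = E 0 (s\<^sup>2)" if "s \<in> {-d<..<d}" for s
    using assms(3)[OF that] by (simp add: E_def \<phi>(1) abs_if)
  ultimately show thesis by (rule that)
qed

section \<open>Taylor coefficients and splitting into even and odd part\<close>

lemma higher_deriv_mult_ident:
  fixes h :: "real \<Rightarrow> real"
  assumes "open S" "smooth_on S h" "x \<in> S"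
  shows "(deriv ^^ Suc k) (\<lambda>s. s * h s + c) x = real (Suc k) * (deriv ^^ k) h x + x * (deriv ^^ Suc k) h x"
  using assms(3)
proof (induction k arbitrary: x)
  case 0
  have "((\<lambda>s. s * h s + c) has_field_derivative h x + x * deriv h x) (at x)"
    using smooth_on_has_field_derivative[OF assms(2) 0]
    by (auto intro!: derivative_eq_intros)
  then show ?case by (simp add: DERIV_imp_deriv)
next
  case (Suc k)
  have "(deriv ^^ Suc (Suc k)) (\<lambda>s. s * h s + c) x =
      deriv (\<lambda>y. real (Suc k) * (deriv ^^ k) h y + y * (deriv ^^ Suc k) h y) x"
  proof -
    have "\<forall>\<^sub>F y in nhds x. (deriv ^^ Suc k) (\<lambda>s. s * h s + c) y =
        real (Suc k) * (deriv ^^ k) h y + y * (deriv ^^ Suc k) h y"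
      using eventually_nhds_in_open[OF assms(1) Suc.prems] by eventually_elim (rule Suc.IH)
    from deriv_cong_ev[OF this refl] show ?thesis by simp
  qed
  also have "\<dots> = real (Suc (Suc k)) * (deriv ^^ Suc k) h x + x * (deriv ^^ Suc (Suc k)) h x"
  proof (rule DERIV_imp_deriv)
    note d = smooth_on_has_higher_deriv[OF assms(1,2) Suc.prems]
    have "((\<lambda>y. real (Suc k) * (deriv ^^ k) h y + y * (deriv ^^ Suc k) h y) has_field_derivative
      real (Suc k) * (deriv ^^ Suc k) h x + (1 * (deriv ^^ Suc k) h x + (deriv ^^ Suc (Suc k)) h x * x)) (at x)"
      by (intro DERIV_add DERIV_cmult DERIV_mult d DERIV_ident)
    then show "((\<lambda>y. real (Suc k) * (deriv ^^ k) h y + y * (deriv ^^ Suc k) h y) has_field_derivative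
      real (Suc (Suc k)) * (deriv ^^ Suc k) h x + x * (deriv ^^ Suc (Suc k)) h x) (at x)"
      by (rule DERIV_cong) (simp add: algebra_simps del: funpow.simps)
  qed
  finally show ?case .
qed

text \<open>Reads the derivatives of f at 0 off its Hadamard quotient; splitting off a factor s
  lowers the order by one.\<close>

lemma higher_deriv_0_if_eq_mult_ident:
  fixes f h :: "real \<Rightarrow> real"
  assumes "open S" "0 \<in> S" "smooth_on S h" "\<And>s. s \<in> S \<Longrightarrow> f s = s * h s + c"
  shows "(deriv ^^ Suc k) f 0 = real (Suc k) * (deriv ^^ k) h 0"
  using higher_deriv_cong[OF assms(1,4,2), where n = "Suc k"] higher_deriv_mult_ident[OF assms(1,3,2), of k c]
  by (simp del: funpow.simps)

text \<open>The even part is E(s^2). The odd part is s times an even function, thus s G(s^2). The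
  vanishing first and third derivatives say that G and G' vanish at 0, so G(y) = y^2 G2(y), and G2
  is the F of the conclusion.\<close>

theorem even_odd_decomposition_order_5:
  fixes f :: "real \<Rightarrow> real"
  assumes "d > 0" "smooth_on {-d<..<d} f" "deriv f 0 = 0" "(deriv ^^ 3) f 0 = 0"
  obtains E F where "smooth_on {-d\<^sup>2<..<d\<^sup>2} E" "smooth_on {-d\<^sup>2<..<d\<^sup>2} F"
    "\<And>s. s \<in> {-d<..<d} \<Longrightarrow> f s = E (s\<^sup>2) + s ^ 5 * F (s\<^sup>2)"
    "deriv E 0 = (deriv ^^ 2) f 0 / 2" "F 0 = (deriv ^^ 5) f 0 / 120"
proof -
  define S where "S = {-d<..<d}"
  define T where "T = {-d\<^sup>2<..<d\<^sup>2}"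
  have S: "open S" "0 \<in> S" "\<And>s. s \<in> S \<Longrightarrow> - s \<in> S" and T: "open T" "0 \<in> T"
    using assms(1) by (auto simp: S_def T_def)
  have sq: "s\<^sup>2 \<in> T" if "s \<in> S" for s
  proof -
    have "s\<^sup>2 < d\<^sup>2" using that unfolding S_def by (auto simp: abs_less_iff intro: abs_square_less_1 power2_less_imp_less simp flip: abs_le_square_iff not_le)
    then show ?thesis using zero_le_power2[of s] unfolding T_def greaterThanLessThan_iff by linarith
  qed
  have had: "\<exists>q. smooth_on T q \<and> (\<forall>y\<in>T. g y = g 0 + y * q y)" if "smooth_on T g" for g :: "real \<Rightarrow> real"
    using hadamard_lemma[of "d\<^sup>2" g] that unfolding T_def by metis
  have f: "smooth_on S f" using assms(2) by (simp add: S_def)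
  have fm: "smooth_on S (\<lambda>s. f (- s))"
    by (rule smooth_on_compose[OF S(1,1) _ f smooth_on_uminus[OF S(1) smooth_on_ident[OF S(1)]]])
      (use S(3) in auto)
  have half: "smooth_on S (\<lambda>s. 1/2 * g s)" if "smooth_on S g" for g :: "real \<Rightarrow> real"
    using smooth_on_mult[OF S(1) smooth_on_const[OF S(1)] that] .
  have whit: "\<exists>E. smooth_on T E \<and> (\<forall>s\<in>S. g s = E (s\<^sup>2))"
    if g: "smooth_on S g" "\<And>s. s \<in> S \<Longrightarrow> g (- s) = g s" for g :: "real \<Rightarrow> real"
  proof -
    obtain E where "smooth_on {..<d\<^sup>2} E" "\<And>s. s \<in> S \<Longrightarrow> g s = E (s\<^sup>2)"
      using whitney_even[OF assms(1), of g] g unfolding S_def by metis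
    moreover have "T \<subseteq> {..<d\<^sup>2}" by (auto simp: T_def)
    ultimately show ?thesis using smooth_on_subset by blast
  qed
  obtain E where E: "smooth_on T E" "\<And>s. s \<in> S \<Longrightarrow> 1/2 * (f s + f (- s)) = E (s\<^sup>2)"
    using whit[OF half[OF smooth_on_add[OF S(1) f fm]]] by (auto simp: add.commute)
  obtain q where q: "smooth_on S q" "\<And>s. s \<in> S \<Longrightarrow> 1/2 * (f s - f (- s)) = s * q s"
    using hadamard_lemma[of d "\<lambda>s. 1/2 * (f s - f (- s))"] half[OF smooth_on_diff[OF S(1) f fm]]
    unfolding S_def by auto
  have "q (- s) = q s" if "s \<in> S" for s
    using q(2)[OF that] q(2)[OF S(3)[OF that]] by (cases "s = 0") (auto simp: field_simps)
  then obtain G where G: "smooth_on T G" "\<And>s. s \<in> S \<Longrightarrow> q s = G (s\<^sup>2)"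
    using whit[OF q(1)] by blast
  have f_eq: "f s = E (s\<^sup>2) + s * G (s\<^sup>2)" if "s \<in> S" for s
    using E(2)[OF that] q(2)[OF that] G(2)[OF that] by (simp add: field_simps)
  \<comment> \<open>If P(y) = P(0) + y P1(y), then H P Q = P(0) + s H Q P1. The arguments trade
    places, and each derivative at 0 costs one such exchange; five of them reach the fifth
    derivative.\<close>
  define H where "H = (\<lambda>P Q s. P (s\<^sup>2) + s * Q (s\<^sup>2) :: real)"
  have H: "smooth_on S (H P Q)" if "smooth_on T P" "smooth_on T Q" for P Q
    unfolding H_def
    by (intro smooth_on_add smooth_on_mult smooth_on_ident S
        smooth_on_compose[OF S(1) T(1) _ that(1)] smooth_on_compose[OF S(1) T(1) _ that(2)]
        smooth_on_power) (use sq in auto)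
  have step: "(deriv ^^ Suc k) (H P Q) 0 = real (Suc k) * (deriv ^^ k) (H Q P1) 0"
    if "smooth_on T P1" "smooth_on T Q" "\<forall>y\<in>T. P y = P 0 + y * P1 y" for P Q P1 k
    by (rule higher_deriv_0_if_eq_mult_ident[OF S(1,2) H[OF that(2,1)], where c = "P 0"])
      (use that(3) sq in \<open>auto simp: H_def algebra_simps power2_eq_square\<close>)
  have f_H: "(deriv ^^ k) f 0 = (deriv ^^ k) (H E G) 0" for k
    by (rule higher_deriv_cong[OF S(1) _ S(2)]) (simp add: f_eq H_def)
  obtain E1 where E1: "smooth_on T E1" "\<forall>y\<in>T. E y = E 0 + y * E1 y" using had[OF E(1)] by blast
  obtain E2 where E2: "smooth_on T E2" "\<forall>y\<in>T. E1 y = E1 0 + y * E2 y" using had[OF E1(1)] by blast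
  obtain E3 where E3: "smooth_on T E3" "\<forall>y\<in>T. E2 y = E2 0 + y * E3 y" using had[OF E2(1)] by blast
  obtain G1 where G1: "smooth_on T G1" "\<forall>y\<in>T. G y = G 0 + y * G1 y" using had[OF G(1)] by blast
  obtain G2 where G2: "smooth_on T G2" "\<forall>y\<in>T. G1 y = G1 0 + y * G2 y" using had[OF G1(1)] by blast
  note steps = step[OF E1(1) G(1) E1(2)] step[OF G1(1) E1(1) G1(2)] step[OF E2(1) G1(1) E2(2)]
    step[OF G2(1) E2(1) G2(2)] step[OF E3(1) G2(1) E3(2)]
  have "deriv f 0 = G 0"
    using f_H[of 1] steps(1)[of 0] by (simp add: H_def)
  moreover have "(deriv ^^ 2) f 0 = 2 * E1 0"
    using f_H[of 2] steps(1)[of 1] steps(2)[of 0] by (simp add: numeral_2_eq_2 H_def)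
  moreover have "(deriv ^^ 3) f 0 = 6 * G1 0"
    using f_H[of 3] steps(1)[of 2] steps(2)[of 1] steps(3)[of 0] by (simp add: numeral_eq_Suc H_def)
  moreover have "(deriv ^^ 5) f 0 = 120 * G2 0"
    using f_H[of 5] steps(1)[of 4] steps(2)[of 3] steps(3)[of 2] steps(4)[of 1] steps(5)[of 0]
    by (simp add: numeral_eq_Suc H_def)
  moreover have "deriv E 0 = E1 0"
    using higher_deriv_0_if_eq_mult_ident[OF T E1(1), of E "E 0" 0] E1(2) by (simp add: add.commute)
  moreover have "f s = E (s\<^sup>2) + s ^ 5 * G2 (s\<^sup>2)" if s: "s \<in> S" for s
  proof -
    have "G (s\<^sup>2) = s ^ 4 * G2 (s\<^sup>2)"
      using G1(2) G2(2) sq[OF s] assms(3,4) calculation(1,3)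
      by (simp add: power2_eq_square power4_eq_xxxx)
    then show ?thesis using f_eq[OF s] by (simp add: power_Suc[symmetric] mult.assoc[symmetric] eval_nat_numeral)
  qed
  ultimately show thesis
    using E(1) G2(1) by (intro that[of E G2]) (auto simp: S_def T_def)
qed

section \<open>Weierstrass data at a singular point that is not a front\<close>

lemma oint_has_vector_derivative:
  assumes "is_interval I" "open I" "a \<in> I" "u \<in> I" "continuous_on I g"
  shows "((\<lambda>x. oint a x g) has_vector_derivative g u) (at u)"
proof -
  have "min a u \<in> I" "max a u \<in> I" using assms by (auto simp: min_def max_def)
  then obtain e1 e2 where e: "e1 > 0" "cball (min a u) e1 \<subseteq> I" "e2 > 0" "cball (max a u) e2 \<subseteq> I"
    using assms(2) open_contains_cball by metis
  \<comment> \<open>A base point l to the left of both a and u turns the two cases of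
    \<open>oint\<close> into the same difference of integrals starting at l.\<close>
  define l r where "l = min a u - e1" and "r = max a u + e2"
  have "l \<in> cball (min a u) e1" "r \<in> cball (max a u) e2"
    using e(1,3) by (simp_all add: l_def r_def dist_real_def)
  note lrI = subsetD[OF e(2) this(1)] subsetD[OF e(4) this(2)]
  have lr: "l < a" "l < u" "a < r" "u < r"
    using e(1,3) unfolding l_def r_def by linarith+
  have sub: "{l..r} \<subseteq> I"
    using mem_is_interval_1_I[OF assms(1) lrI] by auto
  have cont: "continuous_on {l..r} g" using continuous_on_subset[OF assms(5) sub] .
  have int: "g integrable_on {x..y}" if "l \<le> x" "y \<le> r" for x y
    using that by (intro integrable_continuous_interval continuous_on_subset[OF cont]) auto
  have "((\<lambda>x. integral {l..x} g - integral {l..a} g) has_vector_derivative g u - 0) (at u within {l..r})"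
    by (intro has_vector_derivative_diff integral_has_vector_derivative[OF cont] has_vector_derivative_const)
      (use lr in auto)
  then have "((\<lambda>x. integral {l..x} g - integral {l..a} g) has_vector_derivative g u) (at u)"
    using lr by (simp add: at_within_Icc_at)
  then show ?thesis
  proof (rule has_vector_derivative_transform_within_open[where S = "{l<..<r}"])
    fix x assume x: "x \<in> {l<..<r}"
    show "integral {l..x} g - integral {l..a} g = oint a x g"
    proof (cases "a \<le> x")
      case True
      then have "integral {l..a} g + integral {a..x} g = integral {l..x} g"
        using x lr by (intro Henstock_Kurzweil_Integration.integral_combine int) auto
      then show ?thesis using True by (simp add: oint_def algebra_simps)
    next
      case False
      then have "integral {l..x} g + integral {x..a} g = integral {l..a} g"
        using x lr by (intro Henstock_Kurzweil_Integration.integral_combine int) auto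
      then show ?thesis using False by (simp add: oint_def algebra_simps)
    qed
  qed (use lr in auto)
qed

text \<open>With \<open>null2\<close>, the lightlike directions of the two null coordinate curves:
  f_u is w1 / 2 times \<open>null1 (g1 u)\<close>, and f_v is w2 / 2 times
  \<open>null2 (g2 v)\<close>. The first coordinate is the time t.\<close>

definition null1 :: "real \<Rightarrow> real^3" where
  "null1 m = vector [-1 - m\<^sup>2, 1 - m\<^sup>2, 2 * m]"

definition null2 :: "real \<Rightarrow> real^3" where
  "null2 m = vector [1 + m\<^sup>2, 1 - m\<^sup>2, -2 * m]"

lemma null_nth:
  "null1 m $ 1 = -1 - m\<^sup>2" "null1 m $ 2 = 1 - m\<^sup>2" "null1 m $ 3 = 2 * m"
  "null2 m $ 1 = 1 + m\<^sup>2" "null2 m $ 2 = 1 - m\<^sup>2" "null2 m $ 3 = -2 * m"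
  by (simp_all add: null1_def null2_def)

lemma null1_neq_0: "null1 m \<noteq> 0"
proof
  assume "null1 m = 0"
  then have "null1 m $ 1 = 0" by simp
  then show False using zero_le_power2[of m] unfolding null_nth by linarith
qed

lemma smooth_on_null:
  assumes "open S" "smooth_on S g"
  shows "smooth_on S (\<lambda>x. null1 (g x))" "smooth_on S (\<lambda>x. null2 (g x))"
proof -
  have "smooth_on S (\<lambda>x. null1 (g x) $ i)" "smooth_on S (\<lambda>x. null2 (g x) $ i)" for i
    using exhaust_3[of i]
    by (auto simp: null_nth intro!: smooth_on_add smooth_on_diff smooth_on_uminus smooth_on_mult
        smooth_on_power smooth_on_const assms)
  then show "smooth_on S (\<lambda>x. null1 (g x))" "smooth_on S (\<lambda>x. null2 (g x))"
    by (auto intro: smooth_on_vec assms(1))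
qed

text \<open>Everything later uses only this separation of variables and the two velocities, never
  the integrals.\<close>

lemma weierstrass_split:
  assumes "gen_timelike_minimal I J g1 w1 g2 w2 u0 v0 c"
  obtains A B where
    "weierstrass g1 w1 g2 w2 u0 v0 c = (\<lambda>(u, v). A u + B v)"
    "\<And>u. u \<in> I \<Longrightarrow> (A has_vector_derivative (w1 u / 2) *\<^sub>R null1 (g1 u)) (at u)"
    "\<And>v. v \<in> J \<Longrightarrow> (B has_vector_derivative (w2 v / 2) *\<^sub>R null2 (g2 v)) (at v)"
proof -
  have I: "is_interval I" "open I" "is_interval J" "open J" "u0 \<in> I" "v0 \<in> J"
    "smooth_on I g1" "smooth_on I w1" "smooth_on J g2" "smooth_on J w2"
    using assms by (auto simp: gen_timelike_minimal_def Let_def)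
  have "continuous_on I (\<lambda>s. w1 s *\<^sub>R null1 (g1 s))" "continuous_on J (\<lambda>s. w2 s *\<^sub>R null2 (g2 s))"
    by (intro smooth_on_imp_continuous_on smooth_on_scaleR smooth_on_null I)+
  note d = oint_has_vector_derivative[OF I(1,2,5) _ this(1)] oint_has_vector_derivative[OF I(3,4,6) _ this(2)]
  show thesis
  proof
    show "weierstrass g1 w1 g2 w2 u0 v0 c = (\<lambda>(u, v). (1/2) *\<^sub>R oint u0 u (\<lambda>s. w1 s *\<^sub>R null1 (g1 s))
        + ((1/2) *\<^sub>R oint v0 v (\<lambda>s. w2 s *\<^sub>R null2 (g2 s)) + c))"
      by (simp add: weierstrass_def null1_def null2_def add.assoc)
    show "((\<lambda>u. (1/2) *\<^sub>R oint u0 u (\<lambda>s. w1 s *\<^sub>R null1 (g1 s))) has_vector_derivative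
        (w1 u / 2) *\<^sub>R null1 (g1 u)) (at u)" if "u \<in> I" for u
      using has_vector_derivative_scaleR[OF DERIV_const d(1)[OF that], of "1/2"] by simp
    show "((\<lambda>v. (1/2) *\<^sub>R oint v0 v (\<lambda>s. w2 s *\<^sub>R null2 (g2 s)) + c) has_vector_derivative
        (w2 v / 2) *\<^sub>R null2 (g2 v)) (at v)" if "v \<in> J" for v
      using has_vector_derivative_add[OF has_vector_derivative_scaleR[OF DERIV_const d(2)[OF that], of "1/2"]
        has_vector_derivative_const[of c]] by simp
  qed
qed

lemma has_derivative_add_separate:
  fixes A B :: "real \<Rightarrow> 'a::real_normed_vector"
  assumes "(A has_vector_derivative a) (at u)" "(B has_vector_derivative b) (at v)"
  shows "((\<lambda>(u, v). A u + B v) has_derivative (\<lambda>h. fst h *\<^sub>R a + snd h *\<^sub>R b)) (at (u, v))"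
proof -
  have "((\<lambda>z. A (fst z)) has_derivative (\<lambda>h. fst h *\<^sub>R a)) (at (u, v))"
    by (rule has_derivative_compose[where f = fst and g = A])
      (use assms(1) in \<open>auto simp: has_vector_derivative_def intro!: derivative_eq_intros\<close>)
  moreover have "((\<lambda>z. B (snd z)) has_derivative (\<lambda>h. snd h *\<^sub>R b)) (at (u, v))"
    by (rule has_derivative_compose[where f = snd and g = B])
      (use assms(2) in \<open>auto simp: has_vector_derivative_def intro!: derivative_eq_intros\<close>)
  ultimately show ?thesis unfolding case_prod_beta by (rule has_derivative_add)
qed

text \<open>The unit normal before normalization; Euclidean-orthogonal to \<open>null1 a\<close> and
  \<open>null2 b\<close>.\<close>

definition nu :: "real \<Rightarrow> real \<Rightarrow> real^3" where
  "nu a b = vector [a + b, - a + b, 1 + a * b]"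

lemma nu_nth: "nu a b $ 1 = a + b" "nu a b $ 2 = - a + b" "nu a b $ 3 = 1 + a * b"
  by (simp_all add: nu_def)

text \<open>The squared Euclidean length of \<open>nu a b\<close>, in the shape found under the root
  in \<open>wnormal\<close>.\<close>

definition nu_sq :: "real \<Rightarrow> real \<Rightarrow> real" where
  "nu_sq a b = (1 - a * b)\<^sup>2 + 2 * (a + b)\<^sup>2"

lemma nu_sq_pos: "nu_sq a b > 0"
proof -
  have "nu_sq a b = (a + b)\<^sup>2 + (- a + b)\<^sup>2 + (1 + a * b)\<^sup>2"
    by (simp add: nu_sq_def power2_eq_square algebra_simps)
  moreover have "\<not> (a + b = 0 \<and> - a + b = 0 \<and> 1 + a * b = 0)" by auto
  ultimately show ?thesis
    by (metis add_nonneg_eq_0_iff add_nonneg_nonneg less_eq_real_def power_eq_0_iff zero_le_power2)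
qed

lemma wnormal_eq: "wnormal g1 g2 = (\<lambda>(u, v). (1 / sqrt (nu_sq (g1 u) (g2 v))) *\<^sub>R nu (g1 u) (g2 v))"
  by (simp add: wnormal_def nu_def nu_sq_def)

text \<open>The cross product of \<open>null1 a\<close> and \<open>null2 b\<close> is -2 (1 - a b)
  \<open>nu a b\<close>.\<close>

lemma det_null:
  "det (vector [null1 a, null2 b, nu a b] :: real^3^3) = - 2 * (1 - a * b) * nu_sq a b"
  by (simp add: det_3 null_nth nu_nth nu_sq_def power2_eq_square) (simp add: algebra_simps)

lemma det_3_scaleR:
  "det (vector [p *\<^sub>R x, q *\<^sub>R y, r *\<^sub>R z] :: real^3^3) = p * q * r * det (vector [x, y, z] :: real^3^3)"
  by (simp add: det_3 algebra_simps)

text \<open>As f_v = 0 at p, rank one forces f_u, and with it w1, to be nonzero. Next, lambda = w2 K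
  where K is w1 (1 - g1 g2) times a nonzero factor, so d lambda at p is K w2' dv. Finally, f_u
  already detects the u-direction, so (f, n) is an immersion at p as soon as n_v is nonzero, and g2'
  \<noteq> 0 guarantees this.\<close>

lemma non_front_nondegenerate_data:
  assumes surf: "gen_timelike_minimal I J g1 w1 g2 w2 u0 v0 c"
    and f: "f = weierstrass g1 w1 g2 w2 u0 v0 c" and n: "n = wnormal g1 g2"
    and p: "up \<in> I" "vp \<in> J"
    and nondeg: "nondegenerate_singular f n (up, vp)"
    and rank1: "rank_d f (up, vp) = 1"
    and w2p: "w2 vp = 0"
    and not_front: "\<not> front_at f n (up, vp)"
  shows "w1 up \<noteq> 0" "deriv w2 vp \<noteq> 0" "g1 up * g2 vp \<noteq> 1" "deriv g2 vp = 0"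
proof -
  have I: "is_interval I" "open I" "is_interval J" "open J"
    "smooth_on I g1" "smooth_on I w1" "smooth_on J g2" "smooth_on J w2"
    using surf by (auto simp: gen_timelike_minimal_def Let_def)
  obtain A B where AB: "f = (\<lambda>(u, v). A u + B v)"
    "\<And>u. u \<in> I \<Longrightarrow> (A has_vector_derivative (w1 u / 2) *\<^sub>R null1 (g1 u)) (at u)"
    "\<And>v. v \<in> J \<Longrightarrow> (B has_vector_derivative (w2 v / 2) *\<^sub>R null2 (g2 v)) (at v)"
    using weierstrass_split[OF surf] f by metis
  have Df: "(f has_derivative (\<lambda>h. fst h *\<^sub>R (w1 u / 2) *\<^sub>R null1 (g1 u) + snd h *\<^sub>R (w2 v / 2) *\<^sub>R null2 (g2 v))) (at (u, v))"
    if "u \<in> I" "v \<in> J" for u v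
    unfolding AB(1) by (rule has_derivative_add_separate[OF AB(2)[OF that(1)] AB(3)[OF that(2)]])
  note fD = frechet_derivative_at[OF Df, symmetric]
  show w1: "w1 up \<noteq> 0"
  proof
    assume "w1 up = 0"
    then have "frechet_derivative f (at (up, vp)) = (\<lambda>_. 0)" using fD[OF p] w2p by simp
    then show False using rank1 by (simp add: rank_d_def image_constant_conv)
  qed
  note g1' = smooth_on_has_field_derivative[OF I(5) p(1), unfolded has_field_derivative_def]
  note g2' = smooth_on_has_field_derivative[OF I(7) p(2), unfolded has_field_derivative_def]
  note w1' = smooth_on_has_field_derivative[OF I(6) p(1), unfolded has_field_derivative_def]
  note w2' = smooth_on_has_field_derivative[OF I(8) p(2), unfolded has_field_derivative_def]
  have fst': "((\<lambda>z. h (fst z)) has_derivative (\<lambda>t. h' (fst t))) (at (up, vp))"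
    if "(h has_derivative h') (at up)" for h h' :: "real \<Rightarrow> real"
    by (rule has_derivative_compose[where f = fst and g = h]) (use that in \<open>auto intro!: derivative_eq_intros\<close>)
  have snd': "((\<lambda>z. h (snd z)) has_derivative (\<lambda>t. h' (snd t))) (at (up, vp))"
    if "(h has_derivative h') (at vp)" for h h' :: "real \<Rightarrow> real"
    by (rule has_derivative_compose[where f = snd and g = h]) (use that in \<open>auto intro!: derivative_eq_intros\<close>)
  define N where "N = (\<lambda>z. sqrt (nu_sq (g1 (fst z)) (g2 (snd z))))"
  have N_pos: "N z > 0" for z using nu_sq_pos by (simp add: N_def)
  have dg: "(\<lambda>z. g1 (fst z)) differentiable (at (up, vp))" "(\<lambda>z. g2 (snd z)) differentiable (at (up, vp))"
    "(\<lambda>z. w1 (fst z)) differentiable (at (up, vp))"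
    using fst'[OF g1'] snd'[OF g2'] fst'[OF w1'] by (auto simp: differentiable_def)
  have dQ: "(\<lambda>z. nu_sq (g1 (fst z)) (g2 (snd z))) differentiable (at (up, vp))"
    unfolding nu_sq_def using dg by (intro derivative_intros)
  have dN: "N differentiable (at (up, vp))"
  proof -
    obtain D where "((\<lambda>z. nu_sq (g1 (fst z)) (g2 (snd z))) has_derivative D) (at (up, vp))"
      using dQ by (auto simp: differentiable_def)
    from has_derivative_real_sqrt[OF _ this] nu_sq_pos show ?thesis
      unfolding N_def differentiable_def by fastforce
  qed
  define K where "K = (\<lambda>z. - 1 / 2 * w1 (fst z) * (1 - g1 (fst z) * g2 (snd z)) * N z)"
  have "lambda_fn f n z = w2 (snd z) * K z" if z_in: "z \<in> I \<times> J" for z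
  proof -
    obtain u v where z: "z = (u, v)" "u \<in> I" "v \<in> J" using z_in by auto
    have "lambda_fn f n z = (w1 u / 2) * (w2 v / 2) * (1 / N z) * (- 2 * (1 - g1 u * g2 v) * (N z)\<^sup>2)"
      unfolding lambda_fn_def z(1) fD[OF z(2,3)] n wnormal_eq
      using nu_sq_pos[of "g1 u" "g2 v"]
      by (simp add: det_3_scaleR det_null N_def)
    also have "\<dots> = w2 (snd z) * K z"
      using N_pos[of z] by (simp add: K_def z(1) power2_eq_square field_simps)
    finally show ?thesis .
  qed
  moreover have "((\<lambda>z. w2 (snd z) * K z) has_derivative (\<lambda>h. K (up, vp) * (deriv w2 vp * snd h))) (at (up, vp))"
  proof -
    have "K differentiable (at (up, vp))" unfolding K_def using dg dN by (intro derivative_intros)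
    then obtain K' where "(K has_derivative K') (at (up, vp))" by (auto simp: differentiable_def)
    from has_derivative_mult[OF snd'[OF w2'] this] show ?thesis by (simp add: w2p mult.commute)
  qed
  ultimately have "(lambda_fn f n has_derivative (\<lambda>h. K (up, vp) * (deriv w2 vp * snd h))) (at (up, vp))"
    using has_derivative_transform_within_open[of _ _ _ UNIV "I \<times> J" "lambda_fn f n"] open_Times[OF I(2,4)] p by auto
  note fL = frechet_derivative_at[OF this, symmetric]
  have "K (up, vp) * deriv w2 vp \<noteq> 0"
    using nondeg by (auto simp: nondegenerate_singular_def fL)
  then show "deriv w2 vp \<noteq> 0" "g1 up * g2 vp \<noteq> 1" by (auto simp: K_def)
  show "deriv g2 vp = 0"
  proof (rule ccontr)
    assume g2v: "deriv g2 vp \<noteq> 0"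
    have nN: "n z = (1 / N z) *\<^sub>R nu (g1 (fst z)) (g2 (snd z))" for z
      unfolding n wnormal_eq N_def by (simp add: case_prod_beta)
    have dnu: "((\<lambda>z. nu (g1 (fst z)) (g2 (snd z))) has_derivative (\<lambda>h. vector [deriv g1 up * fst h + deriv g2 vp * snd h,
       - (deriv g1 up * fst h) + deriv g2 vp * snd h, g1 up * (deriv g2 vp * snd h) + deriv g1 up * fst h * g2 vp])) (at (up, vp))"
      (is "(_ has_derivative ?D) _")
    proof (rule has_derivative_componentwise_within[THEN iffD2], rule ballI)
      fix b :: "real^3" assume "b \<in> Basis"
      then obtain i where b: "b = axis i 1" by (auto simp: Basis_vec_def)
      note d = fst'[OF g1'] snd'[OF g2']
      show "((\<lambda>z. nu (g1 (fst z)) (g2 (snd z)) \<bullet> b) has_derivative (\<lambda>h. ?D h \<bullet> b)) (at (up, vp))"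
        using exhaust_3[of i] by (auto simp: b inner_axis nu_nth intro!: derivative_eq_intros d)
    qed
    obtain N' where N': "(N has_derivative N') (at (up, vp))" using dN by (auto simp: differentiable_def)
    have "((\<lambda>z. inverse (N z)) has_derivative (\<lambda>h. - (inverse (N (up, vp)) * N' h * inverse (N (up, vp))))) (at (up, vp))"
      using Deriv.has_derivative_inverse[OF _ N'] N_pos by (simp add: less_imp_neq[symmetric])
    from has_derivative_scaleR[OF this dnu] obtain n' where n': "(n has_derivative n') (at (up, vp))"
      unfolding inverse_eq_divide nN[symmetric] by blast
    \<comment> \<open>If n_v = 0, then nu_v = g2' (1, 1, g1) is a multiple r nu. Here r \<noteq> 0
      because g2' \<noteq> 0; the first two coordinates give r g1 = 0, so g1 = 0, and the third
      becomes 0 = r.\<close>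
    have "n' (0, 1) \<noteq> 0"
    proof
      assume 0: "n' (0, 1) = 0"
      have "((\<lambda>z. N z *\<^sub>R n z) has_derivative (\<lambda>h. N (up, vp) *\<^sub>R n' h + N' h *\<^sub>R n (up, vp))) (at (up, vp))"
        by (rule has_derivative_scaleR[OF N' n'])
      moreover have "N z *\<^sub>R n z = nu (g1 (fst z)) (g2 (snd z))" for z
        using N_pos[of z] unfolding nN by simp
      ultimately have "((\<lambda>z. nu (g1 (fst z)) (g2 (snd z))) has_derivative
          (\<lambda>h. N (up, vp) *\<^sub>R n' h + N' h *\<^sub>R n (up, vp))) (at (up, vp))" by simp
      from fun_cong[OF has_derivative_unique[OF dnu this], of "(0, 1)"]
      have "?D (0, 1) = N (up, vp) *\<^sub>R n' (0, 1) + N' (0, 1) *\<^sub>R n (up, vp)" .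
      then have eq: "?D (0, 1) = (N' (0, 1) / N (up, vp)) *\<^sub>R nu (g1 up) (g2 vp)"
        unfolding 0 nN by simp
      define r where "r = N' (0, 1) / N (up, vp)"
      have 1: "deriv g2 vp = r * (g1 up + g2 vp)"
        using arg_cong[OF eq, of "\<lambda>x. x $ 1"] by (simp add: nu_nth r_def)
      have 2: "deriv g2 vp = r * (- g1 up + g2 vp)"
        using arg_cong[OF eq, of "\<lambda>x. x $ 2"] by (simp add: nu_nth r_def)
      have 3: "g1 up * deriv g2 vp = r * (1 + g1 up * g2 vp)"
        using arg_cong[OF eq, of "\<lambda>x. x $ 3"] by (simp add: nu_nth r_def)
      have "r \<noteq> 0" using 1 g2v by auto
      moreover from 1 2 have "r * g1 up = 0" by (simp add: algebra_simps)
      ultimately show False using 3 by simp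
    qed
    moreover have "inj (\<lambda>h. (fst h *\<^sub>R (w1 up / 2) *\<^sub>R null1 (g1 up), n' h))" if "n' (0, 1) \<noteq> 0"
    proof (rule injI)
      fix h k :: "real \<times> real"
      assume *: "(fst h *\<^sub>R (w1 up / 2) *\<^sub>R null1 (g1 up), n' h) = (fst k *\<^sub>R (w1 up / 2) *\<^sub>R null1 (g1 up), n' k)"
      then have fst: "fst h = fst k" using w1 null1_neq_0 by auto
      have "h - k = (snd h - snd k) *\<^sub>R (0, 1)" using fst by (simp add: prod_eq_iff)
      then have "n' (h - k) = (snd h - snd k) *\<^sub>R n' (0, 1)"
        using linear_cmul[OF has_derivative_linear[OF n']] by metis
      moreover have "n' (h - k) = 0"
        using linear_diff[OF has_derivative_linear[OF n']] * by simp
      ultimately show "h = k" using that fst by (simp add: prod_eq_iff)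
    qed
    ultimately have "immersion_at (\<lambda>x. (f x, n x)) (up, vp)"
      unfolding immersion_at_def using has_derivative_Pair[OF Df[OF p] n'] by (auto simp: w2p)
    then show False using not_front by (simp add: front_at_def)
  qed
qed

section \<open>Necessity: an obstruction in the 5-jet\<close>

lemma deriv_shift:
  fixes f :: "real \<Rightarrow> real"
  shows "deriv (\<lambda>x. f (x + a)) = (\<lambda>x. deriv f (x + a))"
  unfolding deriv_def by (simp add: DERIV_shift)

lemma higher_deriv_shift:
  fixes f :: "real \<Rightarrow> real"
  shows "(deriv ^^ n) (\<lambda>x. f (x + a)) = (\<lambda>x. (deriv ^^ n) f (x + a))"
  by (induction n) (simp_all add: deriv_shift)

lemma smooth_on_shift:
  fixes f :: "real \<Rightarrow> real"
  assumes "open S" "open J" "smooth_on J f" "\<And>s. s \<in> S \<Longrightarrow> s + a \<in> J"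
  shows "smooth_on S (\<lambda>s. f (s + a))"
  by (rule smooth_on_compose[OF assms(1,2) _ assms(3) smooth_on_add[OF assms(1) smooth_on_ident smooth_on_const]])
    (use assms in auto)

text \<open>Applied with n = 0 and n = 1 to read Z(0) and Z'(0) off the asymptotics of m.\<close>

lemma lhopital_power:
  fixes m Z :: "real \<Rightarrow> real"
  assumes "(m \<longlongrightarrow> 0) (at 0)" "\<forall>\<^sub>F s in at 0. (m has_field_derivative s * Z s) (at s)"
    "((\<lambda>s. Z s / s ^ n) \<longlongrightarrow> L) (at 0)"
  shows "((\<lambda>s. m s / s ^ (n + 2)) \<longlongrightarrow> L / real (n + 2)) (at 0)"
proof (rule lhopital[where f' = "\<lambda>s. s * Z s" and g' = "\<lambda>s. real (n + 2) * s ^ (n + 1)"])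
  have ne: "\<forall>\<^sub>F s in at 0. s \<noteq> (0::real)" by (simp add: eventually_at_filter)
  show "((\<lambda>s. s ^ (n + 2)) \<longlongrightarrow> 0) (at (0::real))"
    by (rule tendsto_eq_intros refl | simp)+
  show "\<forall>\<^sub>F s in at 0. s ^ (n + 2) \<noteq> (0::real)" "\<forall>\<^sub>F s in at 0. real (n + 2) * s ^ (n + 1) \<noteq> 0"
    using ne by (eventually_elim, simp)+
  show "\<forall>\<^sub>F s in at 0. ((\<lambda>s. s ^ (n + 2)) has_field_derivative real (n + 2) * s ^ (n + 1)) (at s)"
    using DERIV_pow[of "n + 2"] by (intro always_eventually) simp
  have "((\<lambda>s. Z s / s ^ n / real (n + 2)) \<longlongrightarrow> L / real (n + 2)) (at 0)"
    using assms(3) by (rule tendsto_divide) auto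
  then show "((\<lambda>s. s * Z s / (real (n + 2) * s ^ (n + 1))) \<longlongrightarrow> L / real (n + 2)) (at 0)"
  proof (rule Lim_transform_eventually)
    show "\<forall>\<^sub>F s in at 0. Z s / s ^ n / real (n + 2) = s * Z s / (real (n + 2) * s ^ (n + 1))"
      using ne by eventually_elim (simp del: of_nat_add)
  qed
qed (use assms in auto)

text \<open>Dividing w and g' by s gives m' = s Z, with Z combining X and Y smoothly. Since m has
  order exactly 3, Z has a simple zero at 0. X and Y are only known to be differentiable at 0, so
  orders are measured by limits of m / s^j and not by Taylor expansion.\<close>

lemma fifth_power_obstruction:
  fixes w g y m X Y :: "real \<Rightarrow> real"
  assumes "d > 0" "smooth_on {-d<..<d} w" "smooth_on {-d<..<d} g" "smooth_on {-d<..<d} y"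
    "w 0 = 0" "deriv w 0 \<noteq> 0" "deriv g 0 = 0" "y 0 = 0" "deriv y 0 \<noteq> 0"
    and eq: "\<And>s. s \<in> {-d<..<d} \<Longrightarrow> w s * m s = 5 * y s ^ 4 * deriv y s"
    and m': "\<And>s. s \<in> {-d<..<d} \<Longrightarrow> (m has_field_derivative w s * X s + deriv g s * Y s) (at s)"
    and X': "(X has_field_derivative 0) (at 0)" and Y': "(Y has_field_derivative 0) (at 0)"
  shows "(deriv ^^ 3) g 0 * deriv w 0 \<noteq> (deriv ^^ 2) g 0 * (deriv ^^ 2) w 0"
proof
  assume deg: "(deriv ^^ 3) g 0 * deriv w 0 = (deriv ^^ 2) g 0 * (deriv ^^ 2) w 0"
  define S where "S = {-d<..<d}"
  have S: "open S" "0 \<in> S" using assms(1) by (auto simp: S_def)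
  have sm: "smooth_on S w" "smooth_on S (deriv g)" "smooth_on S y"
    using assms(2-4) smooth_on_deriv[OF S(1), of g] by (auto simp: S_def)
  have had: "\<exists>q. smooth_on S q \<and> (\<forall>s\<in>S. f s = s * q s)" if f: "smooth_on S f" "f 0 = 0" for f :: "real \<Rightarrow> real"
  proof -
    obtain q where "smooth_on S q" "\<And>s. s \<in> S \<Longrightarrow> f s = f 0 + s * q s"
      using hadamard_lemma[of d f] f(1) unfolding S_def by metis
    then show ?thesis using f(2) by auto
  qed
  obtain \<omega> where \<omega>: "smooth_on S \<omega>" "\<And>s. s \<in> S \<Longrightarrow> w s = s * \<omega> s" using had[OF sm(1)] assms(5) by auto
  obtain \<gamma> where \<gamma>: "smooth_on S \<gamma>" "\<And>s. s \<in> S \<Longrightarrow> deriv g s = s * \<gamma> s" using had[OF sm(2)] assms(7) by auto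
  obtain k where k: "smooth_on S k" "\<And>s. s \<in> S \<Longrightarrow> y s = s * k s" using had[OF sm(3)] assms(8) by auto
  have hd0: "deriv f 0 = q 0" "(deriv ^^ 2) f 0 = 2 * deriv q 0"
    if "smooth_on S q" "\<And>s. s \<in> S \<Longrightarrow> f s = s * q s" for f q
    using higher_deriv_0_if_eq_mult_ident[OF S that(1), of f 0 0]
      higher_deriv_0_if_eq_mult_ident[OF S that(1), of f 0 1] that(2) by (auto simp: numeral_2_eq_2)
  have w0: "\<omega> 0 = deriv w 0" "2 * deriv \<omega> 0 = (deriv ^^ 2) w 0" using hd0[OF \<omega>] by auto
  have g0: "\<gamma> 0 = (deriv ^^ 2) g 0" "2 * deriv \<gamma> 0 = (deriv ^^ 3) g 0"
    using hd0[OF \<gamma>] by (auto simp: eval_nat_numeral)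
  have k0: "k 0 = deriv y 0" using hd0[OF k] by auto
  have cont: "(f \<longlongrightarrow> f 0) (at 0)" if "smooth_on S f" for f :: "real \<Rightarrow> real"
    using DERIV_isCont[OF smooth_on_has_field_derivative[OF that S(2)]] by (simp add: isCont_def)
  define Z where "Z = (\<lambda>s. \<omega> s * X s + \<gamma> s * Y s)"
  have Z': "(Z has_field_derivative deriv \<omega> 0 * X 0 + deriv \<gamma> 0 * Y 0) (at 0)"
    unfolding Z_def using smooth_on_has_field_derivative[OF \<omega>(1) S(2)] smooth_on_has_field_derivative[OF \<gamma>(1) S(2)] X' Y'
    by (auto intro!: derivative_eq_intros)
  have near: "\<forall>\<^sub>F s in at 0. s \<in> S \<and> s \<noteq> 0"
    using eventually_at_in_open[OF S] by (auto elim: eventually_mono)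
  \<comment> \<open>The factor left after cancelling in w m = 5 y^4 y' with w = s
    \<open>\<omega>\<close> and y = s k, so that m = s^3 q near 0.\<close>
  define q where "q = (\<lambda>s. 5 * k s ^ 4 * deriv y s / \<omega> s)"
  have q: "(q \<longlongrightarrow> q 0) (at 0)" "q 0 \<noteq> 0"
    unfolding q_def
    by (intro tendsto_intros cont \<omega> k smooth_on_deriv S sm) (simp_all add: w0 k0 assms(6,9))
  have mq: "\<forall>\<^sub>F s in at 0. m s = s ^ 3 * q s"
  proof -
    have "\<forall>\<^sub>F s in at 0. \<omega> s \<noteq> 0"
      using tendsto_imp_eventually_ne[OF cont[OF \<omega>(1)]] w0(1) assms(6) by simp
    then show ?thesis using near
    proof eventually_elim
      case (elim s)
      then have "s * \<omega> s * m s = 5 * (s * k s) ^ 4 * deriv y s"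
        using eq[of s] \<omega>(2)[of s] k(2)[of s] by (simp add: S_def)
      then show ?case using elim by (simp add: q_def field_simps power_mult_distrib eval_nat_numeral)
    qed
  qed
  \<comment> \<open>\<open>0 ^ (3 - j)\<close> is 0 for j < 3 and 1 for j = 3, which covers
    vanishing and leading coefficient in one formula.\<close>
  have m_lim: "((\<lambda>s. m s / s ^ j) \<longlongrightarrow> 0 ^ (3 - j) * q 0) (at 0)" if "j \<le> 3" for j
  proof (rule Lim_transform_eventually)
    show "((\<lambda>s. s ^ (3 - j) * q s) \<longlongrightarrow> 0 ^ (3 - j) * q 0) (at 0)" by (intro tendsto_intros q)
    show "\<forall>\<^sub>F s in at 0. s ^ (3 - j) * q s = m s / s ^ j"
      using mq near by eventually_elim (use that in \<open>simp add: power_diff field_simps\<close>)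
  qed
  have m0: "(m \<longlongrightarrow> 0) (at 0)" using m_lim[of 0] by simp
  have mZ: "\<forall>\<^sub>F s in at 0. (m has_field_derivative s * Z s) (at s)"
    using near
  proof eventually_elim
    case (elim s)
    then show ?case using m'[of s] \<omega>(2)[of s] \<gamma>(2)[of s] by (simp add: S_def Z_def algebra_simps)
  qed
  have "(Z \<longlongrightarrow> Z 0) (at 0)" using DERIV_isCont[OF Z'] by (simp add: isCont_def)
  then have "((\<lambda>s. m s / s ^ 2) \<longlongrightarrow> Z 0 / 2) (at 0)"
    using lhopital_power[OF m0 mZ, of 0] by (simp add: power2_eq_square)
  then have Z0: "Z 0 = 0"
    using tendsto_unique[OF _ _ m_lim[of 2]] by fastforce
  have "((\<lambda>s. Z s / s) \<longlongrightarrow> deriv \<omega> 0 * X 0 + deriv \<gamma> 0 * Y 0) (at 0)"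
    using Z' by (simp add: has_field_derivative_iff Z0)
  then have "((\<lambda>s. m s / s ^ 3) \<longlongrightarrow> (deriv \<omega> 0 * X 0 + deriv \<gamma> 0 * Y 0) / 3) (at 0)"
    using lhopital_power[OF m0 mZ, of 1] by (simp add: eval_nat_numeral)
  from tendsto_unique[OF _ this m_lim[of 3]] q(2)
  have "deriv \<omega> 0 * X 0 + deriv \<gamma> 0 * Y 0 \<noteq> 0" by auto
  \<comment> \<open>Under the relation to be refuted, the coefficient vector
    (\<open>\<omega>\<close>, \<open>\<gamma>\<close>) and its derivative are proportional at 0, so
    Z(0) = 0 would force Z'(0) = 0.\<close>
  moreover have "deriv \<gamma> 0 * \<omega> 0 = \<gamma> 0 * deriv \<omega> 0"     using deg unfolding w0(1) g0(1) w0(2)[symmetric] g0(2)[symmetric] by simp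
  then have "\<omega> 0 * (deriv \<omega> 0 * X 0 + deriv \<gamma> 0 * Y 0) = deriv \<omega> 0 * Z 0"
    by (simp add: Z_def algebra_simps)
  ultimately show False using Z0 w0(1) assms(6) by simp
qed

section \<open>Differentiation of functions along a null curve\<close>

text \<open>If $\rho' = \frac12 w\, b(g)$, then $K(\rho, g)' = w K_\rho(\rho, g) + g' K_g(\rho, g)$, where
  $K_\rho$ is \<open>diff_rho K\<close> and $K_g$ is \<open>diff_g K\<close>.\<close>

definition diff_rho :: "((real^3) \<times> real \<Rightarrow> real) \<Rightarrow> (real^3) \<times> real \<Rightarrow> real" where
  "diff_rho K z = frechet_derivative K (at z) ((1/2) *\<^sub>R null2 (snd z), 0)"

definition diff_g :: "((real^3) \<times> real \<Rightarrow> real) \<Rightarrow> (real^3) \<times> real \<Rightarrow> real" where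
  "diff_g K z = frechet_derivative K (at z) (0, 1)"

lemma has_field_derivative_along_null_curve:
  assumes "smooth_on (V \<times> UNIV) K" "\<rho> s \<in> V"
    "(\<rho> has_vector_derivative (w / 2) *\<^sub>R null2 (g s)) (at s)" "(g has_field_derivative g') (at s)"
  shows "((\<lambda>s. K (\<rho> s, g s)) has_field_derivative w * diff_rho K (\<rho> s, g s) + g' * diff_g K (\<rho> s, g s)) (at s)"
proof -
  define D where "D = frechet_derivative K (at (\<rho> s, g s))"
  have D: "(K has_derivative D) (at (\<rho> s, g s))"
    unfolding D_def by (rule smooth_on_has_derivative[OF assms(1)]) (use assms(2) in auto)
  have "((\<lambda>s. (\<rho> s, g s)) has_vector_derivative ((w / 2) *\<^sub>R null2 (g s), g')) (at s)"
    using assms(3,4) by (auto simp: has_real_derivative_iff_has_vector_derivative intro: has_vector_derivative_Pair)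
  then have "((\<lambda>s. K (\<rho> s, g s)) has_derivative (\<lambda>t. D (t *\<^sub>R ((w / 2) *\<^sub>R null2 (g s), g')))) (at s)"
    unfolding has_vector_derivative_def by (rule has_derivative_compose) (rule D)
  moreover have "D (t *\<^sub>R ((w / 2) *\<^sub>R null2 (g s), g')) =
      (w * diff_rho K (\<rho> s, g s) + g' * diff_g K (\<rho> s, g s)) * t" for t
  proof -
    have "t *\<^sub>R ((w / 2) *\<^sub>R null2 (g s), g') = (t * w) *\<^sub>R ((1/2) *\<^sub>R null2 (g s), 0) + (t * g') *\<^sub>R (0, 1)"
      by (simp add: prod_eq_iff)
    moreover have "linear D" using D has_derivative_linear by blast
    ultimately have "D (t *\<^sub>R ((w / 2) *\<^sub>R null2 (g s), g')) =
        (t * w) *\<^sub>R D ((1/2) *\<^sub>R null2 (g s), 0) + (t * g') *\<^sub>R D (0, 1)"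
      by (simp only: linear_add linear_cmul)
    then show ?thesis by (simp add: diff_rho_def diff_g_def D_def algebra_simps)
  qed
  ultimately show ?thesis by (simp add: has_field_derivative_def)
qed

text \<open>Smooth functions of (rho, g) are closed under both operators, so these can be iterated;
  X and Y arise from a second application.\<close>

lemma smooth_on_diff_rho:
  assumes "open V" "smooth_on (V \<times> UNIV) K"
  shows "smooth_on (V \<times> UNIV) (diff_rho K)"
proof -
  have o: "open (V \<times> (UNIV :: real set))" using assms(1) by (intro open_Times) auto
  have "smooth_on (V \<times> UNIV)
      (\<lambda>z. \<Sum>i\<in>UNIV. (1/2 * null2 (snd z) $ i) * frechet_derivative K (at z) (axis i 1, 0))"
    by (intro smooth_on_sum smooth_on_mult smooth_on_const smooth_on_vec_nth smooth_on_null
        smooth_on_bounded_linear smooth_on_frechet_derivative assms(2) o bounded_linear_snd)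
  then show ?thesis
  proof (rule smooth_on_cong[OF o])
    fix z :: "(real^3) \<times> real" assume "z \<in> V \<times> UNIV"
    then have lin: "linear (frechet_derivative K (at z))"
      using smooth_on_has_derivative[OF assms(2)] has_derivative_linear by blast
    have "((1/2) *\<^sub>R null2 (snd z), 0::real) = (\<Sum>i\<in>UNIV. (1/2 * null2 (snd z) $ i) *\<^sub>R (axis i 1, 0))"
      by (simp add: prod_eq_iff vec_eq_iff sum_3 forall_3 axis_def)
    then show "(\<Sum>i\<in>UNIV. (1/2 * null2 (snd z) $ i) * frechet_derivative K (at z) (axis i 1, 0)) = diff_rho K z"
      unfolding diff_rho_def by (simp only: linear_sum[OF lin] linear_cmul[OF lin] real_scaleR_def)
  qed
qed

lemma smooth_on_diff_g:
  assumes "open V" "smooth_on (V \<times> UNIV) K"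
  shows "smooth_on (V \<times> UNIV) (diff_g K)"
proof -
  have o: "open (V \<times> (UNIV :: real set))" using assms(1) by (intro open_Times) auto
  show ?thesis using smooth_on_frechet_derivative[OF o assms(2), of "(0, 1)"] by (simp add: diff_g_def[abs_def])
qed

text \<open>A function of rho alone has no g-derivative, so its derivative along the curve is
  divisible by w. This produces the factorization w m.\<close>

lemma null_curve_smooth_function:
  assumes V: "open V" and h: "smooth_on V h" and \<rho>: "\<rho> s \<in> V"
    "(\<rho> has_vector_derivative (w / 2) *\<^sub>R null2 (g s)) (at s)" "(g has_field_derivative g') (at s)"
  shows "((\<lambda>s. h (\<rho> s)) has_field_derivative w * diff_rho (\<lambda>z. h (fst z)) (\<rho> s, g s)) (at s)"
    "smooth_on (V \<times> UNIV) (\<lambda>z :: (real^3) \<times> real. h (fst z) :: real)"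
proof -
  have o: "open (V \<times> (UNIV :: real set))" using V by (intro open_Times) auto
  show sm: "smooth_on (V \<times> UNIV) (\<lambda>z :: (real^3) \<times> real. h (fst z))"
    by (rule smooth_on_compose[OF o V _ h smooth_on_bounded_linear[OF o bounded_linear_fst]]) auto
  have "((\<lambda>z. h (fst z)) has_derivative (\<lambda>t. frechet_derivative h (at (\<rho> s)) (fst t))) (at (\<rho> s, g s))"
    by (rule has_derivative_compose[where f = fst and g = h])
      (use smooth_on_has_derivative[OF h \<rho>(1)] in \<open>auto intro!: derivative_eq_intros\<close>)
  from frechet_derivative_at[OF this, symmetric]
  have "diff_g (\<lambda>z. h (fst z)) (\<rho> s, g s) = frechet_derivative h (at (\<rho> s)) 0"
    by (simp add: diff_g_def)
  also have "\<dots> = 0" using smooth_on_has_derivative[OF h \<rho>(1)] has_derivative_linear linear_0 by blast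
  finally show "((\<lambda>s. h (\<rho> s)) has_field_derivative w * diff_rho (\<lambda>z. h (fst z)) (\<rho> s, g s)) (at s)"
    using has_field_derivative_along_null_curve[OF sm \<rho>] by simp
qed

text \<open>Everything is restricted to the curve u = up, along which \<open>\<sigma>\<close> is
  written (x, y). With K the third component of \<open>\<tau>\<close>, the obstruction is applied to
  m = \<open>diff_rho K\<close>, X = \<open>diff_rho (diff_rho K)\<close> and Y =
  \<open>diff_g (diff_rho K)\<close>.\<close>

theorem A_equivalent_cuspidal_edge_25_necessary:
  fixes f :: "real \<times> real \<Rightarrow> real^3"
  assumes f: "f = (\<lambda>(u, v). A u + B v)"
    and A: "\<And>u. u \<in> I \<Longrightarrow> (A has_vector_derivative A' u) (at u)"
    and B: "\<And>v. v \<in> J \<Longrightarrow> (B has_vector_derivative (w v / 2) *\<^sub>R null2 (g v)) (at v)"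
    and I: "open I" "open J" "up \<in> I" "vp \<in> J" "smooth_on J g" "smooth_on J w"
    and w: "w vp = 0" "deriv w vp \<noteq> 0" "deriv g vp = 0"
    and eqv: "A_equivalent_at f (up, vp) cuspidal_edge_25 (0, 0)"
  shows "(deriv ^^ 3) g vp * deriv w vp \<noteq> (deriv ^^ 2) g vp * (deriv ^^ 2) w vp"
proof -
  obtain \<sigma> \<tau> U where U: "open U" "(up, vp) \<in> U" "\<sigma> (up, vp) = (0, 0)"
    "local_diffeo_at \<sigma> (up, vp)" "local_diffeo_at \<tau> (f (up, vp))"
    "\<And>x. x \<in> U \<Longrightarrow> \<tau> (f x) = cuspidal_edge_25 (\<sigma> x)"
    using eqv unfolding A_equivalent_at_def by blast
  obtain U1 V1 \<psi> where \<sigma>: "open U1" "(up, vp) \<in> U1" "open V1" "\<sigma> ` U1 = V1" "smooth_on U1 \<sigma>" "smooth_on V1 \<psi>"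
    "\<And>x. x \<in> U1 \<Longrightarrow> \<psi> (\<sigma> x) = x"
    using U(4) unfolding local_diffeo_at_def by blast
  obtain U2 where \<tau>: "open U2" "f (up, vp) \<in> U2" "smooth_on U2 \<tau>"
    using U(5) unfolding local_diffeo_at_def by blast
  have "continuous_on (I \<times> J) f"
  proof (intro continuous_at_imp_continuous_on ballI)
    fix x assume "x \<in> I \<times> J"
    then have "(f has_derivative (\<lambda>h. fst h *\<^sub>R A' (fst x) + snd h *\<^sub>R (w (snd x) / 2) *\<^sub>R null2 (g (snd x)))) (at x)"
      unfolding f using has_derivative_add_separate[OF A B, of "fst x" "snd x"] by auto
    then show "isCont f x" by (rule has_derivative_continuous)
  qed
  then have "open (f -` U2 \<inter> I \<times> J)"
    using continuous_on_open_vimage[of "I \<times> J" f] \<tau>(1) open_Times[OF I(1,2)] by blast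
  then have W: "open (U \<inter> U1 \<inter> (f -` U2 \<inter> I \<times> J))" (is "open ?W") using U(1) \<sigma>(1) by blast
  have "open ((\<lambda>s. (up, s + vp)) -` ?W)"
    by (rule open_vimage[OF W]) (intro continuous_intros)
  moreover have "0 \<in> (\<lambda>s. (up, s + vp)) -` ?W" using U \<sigma> \<tau> I by simp
  ultimately obtain d where d: "d > 0" "ball 0 d \<subseteq> (\<lambda>s. (up, s + vp)) -` ?W"
    using open_contains_ball by metis
  define S where "S = {-d<..<d}"
  have S: "open S" "0 \<in> S" using d by (auto simp: S_def)
  have Sd: "(up, s + vp) \<in> U" "(up, s + vp) \<in> U1" "f (up, s + vp) \<in> U2" "s + vp \<in> J" if "s \<in> S" for s
  proof -
    have "s \<in> ball 0 d" using that by (auto simp: S_def dist_real_def)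
    then show "(up, s + vp) \<in> U" "(up, s + vp) \<in> U1" "f (up, s + vp) \<in> U2" "s + vp \<in> J" using d(2) by auto
  qed
  define \<rho> where "\<rho> = (\<lambda>s. f (up, s + vp))"
  define \<gamma> where "\<gamma> = (\<lambda>s. g (s + vp))"
  define \<omega> where "\<omega> = (\<lambda>s. w (s + vp))"
  define c where "c = (\<lambda>s. \<sigma> (up, s + vp))"
  define x where "x = (\<lambda>s. fst (c s))"
  define y where "y = (\<lambda>s. snd (c s))"
  have \<gamma>: "smooth_on S \<gamma>" and \<omega>: "smooth_on S \<omega>"
    unfolding \<gamma>_def \<omega>_def using I Sd(4) S(1) by (auto intro: smooth_on_shift)
  have \<rho>: "(\<rho> has_vector_derivative (\<omega> s / 2) *\<^sub>R null2 (\<gamma> s)) (at s)" if "s \<in> S" for s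
  proof -
    have "(\<lambda>s. B (s + vp)) = B \<circ> (\<lambda>s. s + vp)" by auto
    moreover have "((B \<circ> (\<lambda>s. s + vp)) has_vector_derivative 1 *\<^sub>R (w (s + vp) / 2) *\<^sub>R null2 (g (s + vp))) (at s)"
      by (rule vector_diff_chain_at) (use B[OF Sd(4)[OF that]] in \<open>auto intro!: derivative_eq_intros\<close>)
    ultimately show ?thesis unfolding \<rho>_def f \<gamma>_def \<omega>_def
      using has_vector_derivative_add[OF has_vector_derivative_const[of "A up"]] by fastforce
  qed
  have \<gamma>': "(\<gamma> has_field_derivative deriv \<gamma> s) (at s)" if "s \<in> S" for s
    using smooth_on_has_field_derivative[OF \<gamma> that] .
  have c: "smooth_on S c"
    unfolding c_def
    by (rule smooth_on_compose[OF S(1) \<sigma>(1) _ \<sigma>(5) smooth_on_Pair[OF S(1) smooth_on_const[OF S(1)]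
            smooth_on_add[OF S(1) smooth_on_ident[OF S(1)] smooth_on_const[OF S(1)]]]])
      (use Sd in auto)
  have x: "smooth_on S x" and y: "smooth_on S y"
    unfolding x_def y_def using c S(1) bounded_linear_fst bounded_linear_snd
    by (auto intro: smooth_on_bounded_linear_compose)
  have \<tau>c: "\<tau> (\<rho> s) = vector [x s, (y s)\<^sup>2, y s ^ 5]" if "s \<in> S" for s
    using U(6)[OF Sd(1)[OF that]] by (simp add: \<rho>_def c_def x_def y_def cuspidal_edge_25_def case_prod_beta)
  have \<rho>U: "\<rho> s \<in> U2" if "s \<in> S" for s using Sd(3)[OF that] by (simp add: \<rho>_def)
  have \<tau>i: "smooth_on U2 (\<lambda>z. \<tau> z $ i)" for i by (rule smooth_on_vec_nth[OF \<tau>(1,3)])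
  have \<omega>0: "\<omega> 0 = 0" and \<gamma>0: "deriv \<gamma> 0 = 0" and \<omega>1: "deriv \<omega> 0 \<noteq> 0"
    using w by (simp_all add: \<omega>_def \<gamma>_def deriv_shift)
  \<comment> \<open>x is the first component of \<open>\<tau>\<close> along \<open>\<rho>\<close>,
    and \<open>\<rho>\<close> has zero velocity at 0; hence x'(0) = 0.\<close>
  have "((\<lambda>s. \<tau> (\<rho> s) $ 1) has_field_derivative 0) (at 0)"
    using null_curve_smooth_function(1)[OF \<tau>(1) \<tau>i[of 1] \<rho>U[OF S(2)] \<rho>[OF S(2)] \<gamma>'[OF S(2)]]
    by (simp only: \<omega>0 mult_zero_left)
  then have "(x has_field_derivative 0) (at 0)"
    by (rule has_field_derivative_transform_within_open[OF _ S]) (simp add: \<tau>c)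
  moreover have "(y has_field_derivative deriv y 0) (at 0)"
    by (rule smooth_on_has_field_derivative[OF y S(2)])
  ultimately have c': "(c has_vector_derivative (0, deriv y 0)) (at 0)"
    using has_vector_derivative_Pair[of x 0 0 UNIV y "deriv y 0"]
    by (simp add: x_def y_def has_real_derivative_iff_has_vector_derivative)
  \<comment> \<open>Otherwise c would have zero velocity at 0, although the inverse
    \<open>\<psi>\<close> maps c to a curve with velocity (0, 1).\<close>
  have y1: "deriv y 0 \<noteq> 0"
  proof
    assume 0: "deriv y 0 = 0"
    have "c 0 \<in> V1" using \<sigma>(2,4) by (auto simp: c_def)
    from smooth_on_has_derivative[OF \<sigma>(6) this]
    have "((\<lambda>s. \<psi> (c s)) has_derivative (\<lambda>t. frechet_derivative \<psi> (at (c 0)) (t *\<^sub>R (0, deriv y 0)))) (at 0)"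
      using c' unfolding has_vector_derivative_def by (rule has_derivative_compose[rotated])
    then have "((\<lambda>s. (up, s + vp)) has_derivative (\<lambda>t. frechet_derivative \<psi> (at (c 0)) (t *\<^sub>R (0, deriv y 0)))) (at 0)"
      by (rule has_derivative_transform_within_open[OF _ S]) (use \<sigma>(7) Sd in \<open>simp add: c_def\<close>)
    moreover have "((\<lambda>s. (up, s + vp)) has_derivative (\<lambda>t. (0, t))) (at 0)"
      by (auto intro!: derivative_eq_intros)
    ultimately have "(\<lambda>t. frechet_derivative \<psi> (at (c 0)) (t *\<^sub>R (0, deriv y 0))) = (\<lambda>t. (0, t))"
      by (rule has_derivative_unique)
    from fun_cong[OF this, of 0] fun_cong[OF this, of 1] show False by (simp add: 0 zero_prod_def)
  qed
  define K where "K = (\<lambda>z :: (real^3) \<times> real. \<tau> (fst z) $ 3)"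
  have K: "smooth_on (U2 \<times> UNIV) K"
    unfolding K_def using null_curve_smooth_function(2)[OF \<tau>(1) \<tau>i \<rho>U[OF S(2)] \<rho>[OF S(2)] \<gamma>'[OF S(2)]] .
  note K1 = smooth_on_diff_rho[OF \<tau>(1) K]
  note along = has_field_derivative_along_null_curve[OF _ \<rho>U \<rho> \<gamma>']
  \<comment> \<open>Both coefficients in the derivative along the curve, \<open>\<omega>\<close> and
    the derivative of \<open>\<gamma>\<close>, vanish at 0.\<close>
  have at0: "((\<lambda>s. L (\<rho> s, \<gamma> s)) has_field_derivative 0) (at 0)" if "smooth_on (U2 \<times> UNIV) L" for L
    using along[OF that S(2) S(2) S(2)] by (simp add: \<omega>0 \<gamma>0)
  have "(deriv ^^ 3) \<gamma> 0 * deriv \<omega> 0 \<noteq> (deriv ^^ 2) \<gamma> 0 * (deriv ^^ 2) \<omega> 0"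
  proof (rule fifth_power_obstruction[OF d(1) \<omega>[unfolded S_def] \<gamma>[unfolded S_def] y[unfolded S_def] \<omega>0 \<omega>1 \<gamma>0 _ y1])
    show "y 0 = 0" using U(3) by (simp add: y_def c_def)
    show "((\<lambda>s. diff_rho K (\<rho> s, \<gamma> s)) has_field_derivative
        \<omega> s * diff_rho (diff_rho K) (\<rho> s, \<gamma> s) + deriv \<gamma> s * diff_g (diff_rho K) (\<rho> s, \<gamma> s)) (at s)"
      if "s \<in> {-d<..<d}" for s
      using along[OF K1] that by (simp add: S_def)
    show "((\<lambda>s. diff_rho (diff_rho K) (\<rho> s, \<gamma> s)) has_field_derivative 0) (at 0)"
      "((\<lambda>s. diff_g (diff_rho K) (\<rho> s, \<gamma> s)) has_field_derivative 0) (at 0)"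
      by (intro at0 smooth_on_diff_rho smooth_on_diff_g \<tau>(1) K1)+
    show "\<omega> s * diff_rho K (\<rho> s, \<gamma> s) = 5 * y s ^ 4 * deriv y s" if "s \<in> {-d<..<d}" for s
    proof -
      have s: "s \<in> S" using that by (simp add: S_def)
      have "((\<lambda>s. \<tau> (\<rho> s) $ 3) has_field_derivative \<omega> s * diff_rho K (\<rho> s, \<gamma> s)) (at s)"
        unfolding K_def using null_curve_smooth_function(1)[OF \<tau>(1) \<tau>i \<rho>U[OF s] \<rho>[OF s] \<gamma>'[OF s]] .
      then have "((\<lambda>s. y s ^ 5) has_field_derivative \<omega> s * diff_rho K (\<rho> s, \<gamma> s)) (at s)"
        by (rule has_field_derivative_transform_within_open[OF _ S(1) s]) (simp add: \<tau>c)
      moreover have "((\<lambda>s. y s ^ 5) has_field_derivative 5 * y s ^ 4 * deriv y s) (at s)"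
        using smooth_on_has_field_derivative[OF y s] by (auto intro!: derivative_eq_intros)
      ultimately show ?thesis by (rule DERIV_unique)
    qed
  qed
  then show ?thesis
    by (simp add: \<omega>_def \<gamma>_def higher_deriv_shift deriv_shift)
qed

section \<open>Sufficiency: a normal form via a local diffeomorphism of the target\<close>

lemma higher_deriv_Suc_eq:
  fixes f f' :: "real \<Rightarrow> real"
  assumes "open S" "\<And>x. x \<in> S \<Longrightarrow> (f has_field_derivative f' x) (at x)" "x \<in> S"
  shows "(deriv ^^ Suc n) f x = (deriv ^^ n) f' x"
proof -
  have "(deriv ^^ n) (deriv f) x = (deriv ^^ n) f' x"
    by (rule higher_deriv_cong[OF assms(1) _ assms(3)]) (use assms(2) in \<open>simp add: DERIV_imp_deriv\<close>)
  then show ?thesis by (simp add: funpow_swap1)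
qed

text \<open>With B' = w q / 2 these two orders give the third and the fifth derivative of B.\<close>

lemma higher_deriv_mult:
  fixes p q :: "real \<Rightarrow> real"
  assumes "open S" "smooth_on S p" "smooth_on S q" "x \<in> S"
  shows "(deriv ^^ 2) (\<lambda>x. p x * q x) x =
      (deriv ^^ 2) p x * q x + 2 * deriv p x * deriv q x + p x * (deriv ^^ 2) q x" (is ?thesis2)
    and "(deriv ^^ 4) (\<lambda>x. p x * q x) x =
      (deriv ^^ 4) p x * q x + 4 * (deriv ^^ 3) p x * deriv q x + 6 * (deriv ^^ 2) p x * (deriv ^^ 2) q x
      + 4 * deriv p x * (deriv ^^ 3) q x + p x * (deriv ^^ 4) q x" (is ?thesis4)
proof -
  define P where "P = (\<lambda>k. (deriv ^^ k) p)"
  define Q where "Q = (\<lambda>k. (deriv ^^ k) q)"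
  have P: "(P k has_field_derivative P (Suc k) x) (at x)" if "x \<in> S" for k x
    unfolding P_def using smooth_on_has_higher_deriv[OF assms(1,2) that] .
  have Q: "(Q k has_field_derivative Q (Suc k) x) (at x)" if "x \<in> S" for k x
    unfolding Q_def using smooth_on_has_higher_deriv[OF assms(1,3) that] .
  define h1 where "h1 = (\<lambda>x. P 1 x * Q 0 x + P 0 x * Q 1 x)"
  define h2 where "h2 = (\<lambda>x. P 2 x * Q 0 x + 2 * P 1 x * Q 1 x + P 0 x * Q 2 x)"
  define h3 where "h3 = (\<lambda>x. P 3 x * Q 0 x + 3 * P 2 x * Q 1 x + 3 * P 1 x * Q 2 x + P 0 x * Q 3 x)"
  define h4 where "h4 = (\<lambda>x. P 4 x * Q 0 x + 4 * P 3 x * Q 1 x + 6 * P 2 x * Q 2 x + 4 * P 1 x * Q 3 x + P 0 x * Q 4 x)"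
  have e: "Suc 0 = 1" "Suc 1 = 2" "Suc 2 = 3" "Suc 3 = 4" by simp_all
  note PQ = P[where k = 0, unfolded e] P[where k = 1, unfolded e] P[where k = 2, unfolded e] P[where k = 3, unfolded e]
    Q[where k = 0, unfolded e] Q[where k = 1, unfolded e] Q[where k = 2, unfolded e] Q[where k = 3, unfolded e]
  have d0: "((\<lambda>x. p x * q x) has_field_derivative h1 x) (at x)" if "x \<in> S" for x
  proof -
    have "((\<lambda>x. P 0 x * Q 0 x) has_field_derivative h1 x) (at x)"
      unfolding h1_def by (rule derivative_eq_intros refl PQ that)+ (simp add: algebra_simps)
    then show ?thesis by (simp add: P_def Q_def)
  qed
  have d1: "(h1 has_field_derivative h2 x) (at x)" if "x \<in> S" for x
    unfolding h1_def h2_def by (rule derivative_eq_intros refl PQ that)+ (simp add: algebra_simps)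
  have d2: "(h2 has_field_derivative h3 x) (at x)" if "x \<in> S" for x
    unfolding h2_def h3_def by (rule derivative_eq_intros refl PQ that)+ (simp add: algebra_simps)
  have d3: "(h3 has_field_derivative h4 x) (at x)" if "x \<in> S" for x
    unfolding h3_def h4_def by (rule derivative_eq_intros refl PQ that)+ (simp add: algebra_simps)
  have "(deriv ^^ 2) (\<lambda>x. p x * q x) x = h2 x"
    using higher_deriv_Suc_eq[OF assms(1) d0 assms(4), of 1] higher_deriv_Suc_eq[OF assms(1) d1 assms(4), of 0]
    by (simp add: eval_nat_numeral)
  then show ?thesis2 by (simp add: h2_def P_def Q_def)
  have "(deriv ^^ 4) (\<lambda>x. p x * q x) x = h4 x"
    using higher_deriv_Suc_eq[OF assms(1) d0 assms(4), of 3] higher_deriv_Suc_eq[OF assms(1) d1 assms(4), of 2]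
      higher_deriv_Suc_eq[OF assms(1) d2 assms(4), of 1] higher_deriv_Suc_eq[OF assms(1) d3 assms(4), of 0]
    by (simp add: eval_nat_numeral)
  then show ?thesis4 by (simp add: h4_def P_def Q_def)
qed

text \<open>Each coordinate of \<open>null2 (g s)\<close> is such a quadratic polynomial in g. At a
  critical point of g, every term of the third derivative other than that with g''' contains a
  factor g'.\<close>

lemma higher_deriv_quadratic:
  fixes g :: "real \<Rightarrow> real" and a b c :: real
  assumes "open S" "smooth_on S g" "x \<in> S" "deriv g x = 0"
  defines "q \<equiv> \<lambda>x. a + b * g x + c * (g x)\<^sup>2"
  shows "smooth_on S q" "deriv q x = 0" "(deriv ^^ 3) q x = (b + 2 * c * g x) * (deriv ^^ 3) g x"
proof -
  show "smooth_on S q"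
    unfolding q_def by (intro smooth_on_add smooth_on_mult smooth_on_power smooth_on_const assms)
  define G where "G = (\<lambda>k. (deriv ^^ k) g)"
  have G: "(G k has_field_derivative G (Suc k) x) (at x)" if "x \<in> S" for k x
    unfolding G_def using smooth_on_has_higher_deriv[OF assms(1,2) that] .
  have e: "Suc 0 = 1" "Suc 1 = 2" "Suc 2 = 3" by simp_all
  note GG = G[where k = 0, unfolded e] G[where k = 1, unfolded e] G[where k = 2, unfolded e]
  define h1 where "h1 = (\<lambda>x. (b + 2 * c * G 0 x) * G 1 x)"
  define h2 where "h2 = (\<lambda>x. 2 * c * (G 1 x)\<^sup>2 + (b + 2 * c * G 0 x) * G 2 x)"
  define h3 where "h3 = (\<lambda>x. 6 * c * G 1 x * G 2 x + (b + 2 * c * G 0 x) * G 3 x)"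
  have d0: "(q has_field_derivative h1 x) (at x)" if "x \<in> S" for x
  proof -
    have "((\<lambda>x. a + b * G 0 x + c * (G 0 x)\<^sup>2) has_field_derivative h1 x) (at x)"
      unfolding h1_def by (rule derivative_eq_intros refl GG that)+ (simp add: algebra_simps)
    then show ?thesis by (simp add: q_def G_def)
  qed
  have d1: "(h1 has_field_derivative h2 x) (at x)" if "x \<in> S" for x
    unfolding h1_def h2_def by (rule derivative_eq_intros refl GG that)+ (simp add: algebra_simps power2_eq_square)
  have d2: "(h2 has_field_derivative h3 x) (at x)" if "x \<in> S" for x
    unfolding h2_def h3_def by (rule derivative_eq_intros refl GG that)+ (simp add: algebra_simps power2_eq_square)
  have G1: "G 1 x = 0" using assms(4) by (simp add: G_def)
  show "deriv q x = 0" using DERIV_imp_deriv[OF d0[OF assms(3)]] G1 by (simp add: h1_def)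
  have "(deriv ^^ 3) q x = h3 x"
    using higher_deriv_Suc_eq[OF assms(1) d0 assms(3), of 2] higher_deriv_Suc_eq[OF assms(1) d1 assms(3), of 1]
      higher_deriv_Suc_eq[OF assms(1) d2 assms(3), of 0]
    by (simp add: eval_nat_numeral)
  then show "(deriv ^^ 3) q x = (b + 2 * c * g x) * (deriv ^^ 3) g x"
    using G1 by (simp add: h3_def G_def)
qed

section \<open>Decomposition of the singular null curve\<close>

lemma has_vector_derivative_vec_nth:
  "(f has_vector_derivative f') F \<Longrightarrow> ((\<lambda>x. f x $ i) has_field_derivative f' $ i) F"
  unfolding has_real_derivative_iff_has_vector_derivative
  by (rule bounded_linear.has_vector_derivative[OF bounded_linear_vec_nth])

lemma has_vector_derivative_vec:
  fixes f :: "real \<Rightarrow> real^'n"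
  assumes "\<And>i. ((\<lambda>x. f x $ i) has_field_derivative f' $ i) (at x)"
  shows "(f has_vector_derivative f') (at x)"
  unfolding has_vector_derivative_def
proof (rule has_derivative_componentwise_within[THEN iffD2], rule ballI)
  fix b :: "real^'n" assume "b \<in> Basis"
  then obtain i where b: "b = axis i 1" by (auto simp: Basis_vec_def)
  show "((\<lambda>x. f x \<bullet> b) has_derivative (\<lambda>t. (t *\<^sub>R f') \<bullet> b)) (at x)"
    using assms[of i] by (simp add: b inner_axis has_field_derivative_def mult_commute_abs)
qed

definition null2_deriv :: "real \<Rightarrow> real^3" where
  "null2_deriv m = vector [2 * m, - 2 * m, - 2]"

lemma null2_deriv_nth: "null2_deriv m $ 1 = 2 * m" "null2_deriv m $ 2 = - 2 * m" "null2_deriv m $ 3 = - 2"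
  by (simp_all add: null2_deriv_def)

text \<open>Coordinatewise the velocity is w q / 2 with q'(0) = 0. The first and third derivatives
  vanish with w, w'' and q'. The second is w' q / 2, halved once more in E'; the fifth is (w'''' q +
  4 w' q''') / 2, and 240 = 2 * 5!.\<close>

lemma null_curve_decomposition:
  fixes \<gamma> :: "real \<Rightarrow> real^3" and w g :: "real \<Rightarrow> real"
  assumes d: "d > 0" and sm: "smooth_on {-d<..<d} w" "smooth_on {-d<..<d} g"
    and w: "w 0 = 0" "(deriv ^^ 2) w 0 = 0" and g: "deriv g 0 = 0"
    and \<gamma>: "\<And>s. s \<in> {-d<..<d} \<Longrightarrow> (\<gamma> has_vector_derivative (w s / 2) *\<^sub>R null2 (g s)) (at s)"
  obtains E F :: "real \<Rightarrow> real^3" where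
    "smooth_on {-d\<^sup>2<..<d\<^sup>2} E" "smooth_on {-d\<^sup>2<..<d\<^sup>2} F"
    "\<And>s. s \<in> {-d<..<d} \<Longrightarrow> \<gamma> s = E (s\<^sup>2) + s ^ 5 *\<^sub>R F (s\<^sup>2)"
    "(E has_vector_derivative (deriv w 0 / 4) *\<^sub>R null2 (g 0)) (at 0)"
    "F 0 = (1 / 240) *\<^sub>R ((deriv ^^ 4) w 0 *\<^sub>R null2 (g 0) + (4 * deriv w 0 * (deriv ^^ 3) g 0) *\<^sub>R null2_deriv (g 0))"
proof -
  define S where "S = {-d<..<d}"
  define T where "T = {-d\<^sup>2<..<d\<^sup>2}"
  have S: "open S" "0 \<in> S" and T: "open T" "0 \<in> T" using d by (auto simp: S_def T_def)
  have sm': "smooth_on S w" "smooth_on S g" using sm by (simp_all add: S_def)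
  have "\<exists>E F. smooth_on T E \<and> smooth_on T F \<and> (\<forall>s\<in>S. \<gamma> s $ i = E (s\<^sup>2) + s ^ 5 * F (s\<^sup>2)) \<and>
      deriv E 0 = deriv w 0 / 4 * null2 (g 0) $ i \<and>
      F 0 = 1 / 240 * ((deriv ^^ 4) w 0 * null2 (g 0) $ i + (4 * deriv w 0 * (deriv ^^ 3) g 0) * null2_deriv (g 0) $ i)"
    for i
  proof -
    have "\<exists>a b c. \<forall>m. null2 m $ i = a + b * m + c * m\<^sup>2 \<and> null2_deriv m $ i = b + 2 * c * m"
    proof -
      consider "i = 1" | "i = 2" | "i = 3" using exhaust_3 by blast
      then show ?thesis
      proof cases
        case 1 then show ?thesis by (intro exI[of _ 1] exI[of _ 0]) (auto simp: null_nth null2_deriv_nth)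
      next
        case 2 then show ?thesis by (intro exI[of _ 1] exI[of _ 0] exI[of _ "-1"]) (auto simp: null_nth null2_deriv_nth)
      next
        case 3 then show ?thesis by (intro exI[of _ 0] exI[of _ "-2"] exI[of _ 0]) (auto simp: null_nth null2_deriv_nth)
      qed
    qed
    then obtain a b c where abc: "\<And>m. null2 m $ i = a + b * m + c * m\<^sup>2" "\<And>m. null2_deriv m $ i = b + 2 * c * m"
      by blast
    define q where "q = (\<lambda>s. a + b * g s + c * (g s)\<^sup>2)"
    note q = higher_deriv_quadratic[OF S(1) sm'(2) S(2) g, of a b c, folded q_def]
    have half: "smooth_on S (\<lambda>s. q s / 2)"
      using smooth_on_divide[OF S(1) q(1) smooth_on_const[OF S(1), of 2]] by simp
    have hq: "(deriv ^^ k) (\<lambda>s. q s / 2) s = (deriv ^^ k) q s / 2" if "s \<in> S" for k s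
      using that
    proof (induction k arbitrary: s)
      case (Suc k)
      have "\<forall>\<^sub>F s in nhds s. (deriv ^^ k) (\<lambda>s. q s / 2) s = (deriv ^^ k) q s / 2"
        using eventually_nhds_in_open[OF S(1) Suc.prems] by eventually_elim (rule Suc.IH)
      then have "(deriv ^^ Suc k) (\<lambda>s. q s / 2) s = deriv (\<lambda>s. (deriv ^^ k) q s / 2) s"
        by (simp add: deriv_cong_ev)
      also have "\<dots> = (deriv ^^ Suc k) q s / 2"
        by (rule DERIV_imp_deriv, rule DERIV_cdivide, rule smooth_on_has_higher_deriv[OF S(1) q(1) Suc.prems])
      finally show ?case .
    qed simp
    have d\<gamma>: "((\<lambda>s. \<gamma> s $ i) has_field_derivative w s * (q s / 2)) (at s)" if "s \<in> S" for s
      using has_vector_derivative_vec_nth[OF \<gamma>, of s i] that by (simp add: S_def abc q_def)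
    have sm\<gamma>: "smooth_on S (\<lambda>s. \<gamma> s $ i)"
      by (rule smooth_on_antiderivative[OF S(1) smooth_on_mult[OF S(1) sm'(1) half] d\<gamma>])
    note up = higher_deriv_Suc_eq[OF S(1) d\<gamma> S(2)]
    note lb = higher_deriv_mult[OF S(1) sm'(1) half S(2), unfolded hq[OF S(2)]]
    have hq1: "deriv (\<lambda>s. q s / 2) 0 = deriv q 0 / 2" using hq[OF S(2), of 1] by simp
    have 1: "deriv (\<lambda>s. \<gamma> s $ i) 0 = 0" using up[of 0] w by simp
    have 2: "(deriv ^^ 2) (\<lambda>s. \<gamma> s $ i) 0 = deriv w 0 * q 0 / 2"
    proof -
      have "((\<lambda>s. w s * (q s / 2)) has_field_derivative deriv w 0 * (q 0 / 2) + deriv (\<lambda>s. q s / 2) 0 * w 0) (at 0)"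
        by (intro DERIV_mult smooth_on_has_field_derivative[OF _ S(2)] sm' half)
      from DERIV_imp_deriv[OF this] show ?thesis using up[of 1] w by (simp add: numeral_2_eq_2)
    qed
    have 3: "(deriv ^^ 3) (\<lambda>s. \<gamma> s $ i) 0 = 0"
      using up[of 2] lb(1) w q(2) hq1 by (simp add: eval_nat_numeral)
    have 5: "(deriv ^^ 5) (\<lambda>s. \<gamma> s $ i) 0 =
        ((deriv ^^ 4) w 0 * q 0 + 4 * deriv w 0 * (b + 2 * c * g 0) * (deriv ^^ 3) g 0) / 2"
    proof -
      have "(deriv ^^ 5) (\<lambda>s. \<gamma> s $ i) 0 = (deriv ^^ 4) (\<lambda>s. w s * (q s / 2)) 0"
        using up[of 4] by (simp only: eval_nat_numeral) 
      then show ?thesis unfolding lb(2) hq1 q(2,3) w by (simp add: field_simps)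
    qed
    obtain E F where EF: "smooth_on T E" "smooth_on T F" "\<And>s. s \<in> S \<Longrightarrow> \<gamma> s $ i = E (s\<^sup>2) + s ^ 5 * F (s\<^sup>2)"
      "deriv E 0 = (deriv ^^ 2) (\<lambda>s. \<gamma> s $ i) 0 / 2" "F 0 = (deriv ^^ 5) (\<lambda>s. \<gamma> s $ i) 0 / 120"
      using even_odd_decomposition_order_5[OF d sm\<gamma>[unfolded S_def] 1 3] unfolding S_def T_def by blast
    have "q 0 = null2 (g 0) $ i" by (simp add: abc q_def)
    then show ?thesis
      using EF by (intro exI[of _ E] exI[of _ F]) (simp add: 2 5 abc(2) field_simps)
  qed
  then obtain E F where EF: "\<And>i. smooth_on T (E i)" "\<And>i. smooth_on T (F i)"
      "\<And>i s. s \<in> S \<Longrightarrow> \<gamma> s $ i = E i (s\<^sup>2) + s ^ 5 * F i (s\<^sup>2)"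
      "\<And>i. deriv (E i) 0 = deriv w 0 / 4 * null2 (g 0) $ i"
      "\<And>i. F i 0 = 1 / 240 * ((deriv ^^ 4) w 0 * null2 (g 0) $ i + (4 * deriv w 0 * (deriv ^^ 3) g 0) * null2_deriv (g 0) $ i)"
    by metis
  show thesis
  proof
    show "smooth_on {-d\<^sup>2<..<d\<^sup>2} (\<lambda>y. \<chi> i. E i y)" "smooth_on {-d\<^sup>2<..<d\<^sup>2} (\<lambda>y. \<chi> i. F i y)"
      using EF(1,2) T(1) by (auto simp: T_def intro!: smooth_on_vec)
    show "\<gamma> s = (\<chi> i. E i (s\<^sup>2)) + s ^ 5 *\<^sub>R (\<chi> i. F i (s\<^sup>2))" if "s \<in> {-d<..<d}" for s
      using EF(3) that by (simp add: vec_eq_iff S_def)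
    show "((\<lambda>y. \<chi> i. E i y) has_vector_derivative (deriv w 0 / 4) *\<^sub>R null2 (g 0)) (at 0)"
      using smooth_on_has_field_derivative[OF EF(1) T(2)] EF(4) by (intro has_vector_derivative_vec) simp
    show "(\<chi> i. F i 0) = (1 / 240) *\<^sub>R ((deriv ^^ 4) w 0 *\<^sub>R null2 (g 0)
        + (4 * deriv w 0 * (deriv ^^ 3) g 0) *\<^sub>R null2_deriv (g 0))"
      using EF(5) by (simp add: vec_eq_iff)
  qed
qed

text \<open>The parameter change $v = v_p + s / (1 - \kappa s)$ with $\kappa = - w'' / (6 w')$ makes the
  second derivative of the transformed weight $w(v)\,v'(s)$ vanish.\<close>

lemma moebius_reparametrization:
  fixes w g :: "real \<Rightarrow> real"
  assumes J: "open J" "vp \<in> J" "smooth_on J w" "smooth_on J g"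
    and w: "w vp = 0" "deriv w vp \<noteq> 0" and g: "deriv g vp = 0"
    and B: "\<And>v. v \<in> J \<Longrightarrow> (B has_vector_derivative (w v / 2) *\<^sub>R null2 (g v)) (at v)"
  defines "\<kappa> \<equiv> - (deriv ^^ 2) w vp / (6 * deriv w vp)"
  obtains d \<omega> \<gamma> where "d > 0" "smooth_on {-d<..<d} \<omega>" "smooth_on {-d<..<d} \<gamma>"
    "\<omega> 0 = 0" "deriv \<omega> 0 = deriv w vp" "(deriv ^^ 2) \<omega> 0 = 0" "\<gamma> 0 = g vp" "deriv \<gamma> 0 = 0"
    "deriv w vp * (deriv ^^ 3) \<gamma> 0 = (deriv ^^ 3) g vp * deriv w vp - (deriv ^^ 2) g vp * (deriv ^^ 2) w vp"
    "\<And>s. s \<in> {-d<..<d} \<Longrightarrow>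
       ((\<lambda>s. B (vp + s / (1 - \<kappa> * s))) has_vector_derivative (\<omega> s / 2) *\<^sub>R null2 (\<gamma> s)) (at s)"
proof -
  define W where "W = {s. 1 - \<kappa> * s > 0}"
  have W: "open W" unfolding W_def by (intro open_Collect_less continuous_intros)
  define r where "r = (\<lambda>s. 1 / (1 - \<kappa> * s))"
  define V where "V = (\<lambda>s. vp + s * r s)"
  have r': "(r has_field_derivative \<kappa> * (r s)\<^sup>2) (at s)" if "s \<in> W" for s
    unfolding r_def using that
    by (auto simp: W_def power2_eq_square intro!: derivative_eq_intros)
  have V': "(V has_field_derivative (r s)\<^sup>2) (at s)" if "s \<in> W" for s
  proof -
    have "(V has_field_derivative r s + s * (\<kappa> * (r s)\<^sup>2)) (at s)"
      unfolding V_def by (auto intro!: derivative_eq_intros r' that)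
    moreover have "r s = (1 - \<kappa> * s) * (r s)\<^sup>2"
      using that by (simp add: r_def W_def power2_eq_square)
    then have "r s + s * (\<kappa> * (r s)\<^sup>2) = (r s)\<^sup>2" by (simp add: algebra_simps)
    ultimately show ?thesis by simp
  qed
  have smr: "smooth_on W r"
    unfolding r_def by (intro smooth_on_divide smooth_on_diff smooth_on_mult smooth_on_const smooth_on_ident W)
      (auto simp: W_def)
  have smV: "smooth_on W V"
    unfolding V_def by (intro smooth_on_add smooth_on_mult smooth_on_const smooth_on_ident W smr)
  have "open (V -` J \<inter> W)"
    using continuous_on_open_vimage[OF W] smooth_on_imp_continuous_on[OF smV] J(1) by blast
  moreover have "0 \<in> V -` J \<inter> W" using J by (simp add: V_def W_def)
  ultimately obtain d where d: "d > 0" "ball 0 d \<subseteq> V -` J \<inter> W" using open_contains_ball by metis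
  define S where "S = {-d<..<d}"
  have S: "open S" "0 \<in> S" using d by (auto simp: S_def)
  have "S = ball 0 d" by (auto simp: S_def dist_real_def)
  then have SW: "S \<subseteq> W" and SJ: "\<And>s. s \<in> S \<Longrightarrow> V s \<in> J" using d(2) by auto
  have V1: "(V has_field_derivative (r s)\<^sup>2) (at s)" and r1: "(r has_field_derivative \<kappa> * (r s)\<^sup>2) (at s)"
    if "s \<in> S" for s using V' r' SW that by auto
  have smV': "smooth_on S V" "smooth_on S r" using smooth_on_subset[OF smV SW] smooth_on_subset[OF smr SW] .
  \<comment> \<open>The weight of the reparametrized curve is w(V) V', and V' = r^2.\<close>
  define \<omega> where "\<omega> = (\<lambda>s. w (V s) * (r s)\<^sup>2)"
  define \<gamma> where "\<gamma> = (\<lambda>s. g (V s))"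
  have sm\<gamma>: "smooth_on S \<gamma>"
    unfolding \<gamma>_def by (rule smooth_on_compose[OF S(1) J(1) _ J(4) smV'(1)]) (use SJ in auto)
  have "smooth_on S (\<lambda>s. w (V s))"
    by (rule smooth_on_compose[OF S(1) J(1) _ J(3) smV'(1)]) (use SJ in auto)
  then have sm\<omega>: "smooth_on S \<omega>"
    unfolding \<omega>_def by (intro smooth_on_mult smooth_on_power smV' S)
  have w': "((\<lambda>s. (deriv ^^ k) w (V s)) has_field_derivative (deriv ^^ Suc k) w (V s) * (r s)\<^sup>2) (at s)"
    and g': "((\<lambda>s. (deriv ^^ k) g (V s)) has_field_derivative (deriv ^^ Suc k) g (V s) * (r s)\<^sup>2) (at s)"
    if "s \<in> S" for k s
    by (rule DERIV_chain2[OF _ V1[OF that]], rule smooth_on_has_higher_deriv[OF J(1) _ SJ[OF that]], rule J)+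
  have e: "Suc 0 = 1" "Suc 1 = 2" "Suc 2 = 3" by simp_all
  note w01 = w'[where k = 0, unfolded e] w'[where k = 1, unfolded e]
  note g012 = g'[where k = 0, unfolded e] g'[where k = 1, unfolded e] g'[where k = 2, unfolded e]
  define \<omega>1 where "\<omega>1 = (\<lambda>s. (deriv ^^ 1) w (V s) * r s ^ 4 + 2 * \<kappa> * (deriv ^^ 0) w (V s) * r s ^ 3)"
  define \<omega>2 where "\<omega>2 = (\<lambda>s. (deriv ^^ 2) w (V s) * r s ^ 6 + 6 * \<kappa> * (deriv ^^ 1) w (V s) * r s ^ 5
    + 6 * \<kappa>\<^sup>2 * (deriv ^^ 0) w (V s) * r s ^ 4)"
  define \<gamma>1 where "\<gamma>1 = (\<lambda>s. (deriv ^^ 1) g (V s) * (r s)\<^sup>2)"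
  define \<gamma>2 where "\<gamma>2 = (\<lambda>s. (deriv ^^ 2) g (V s) * r s ^ 4 + 2 * \<kappa> * (deriv ^^ 1) g (V s) * r s ^ 3)"
  define \<gamma>3 where "\<gamma>3 = (\<lambda>s. (deriv ^^ 3) g (V s) * r s ^ 6 + 6 * \<kappa> * (deriv ^^ 2) g (V s) * r s ^ 5
    + 6 * \<kappa>\<^sup>2 * (deriv ^^ 1) g (V s) * r s ^ 4)"
  have D: "(\<omega> has_field_derivative \<omega>1 s) (at s)" "(\<omega>1 has_field_derivative \<omega>2 s) (at s)"
    "(\<gamma> has_field_derivative \<gamma>1 s) (at s)" "(\<gamma>1 has_field_derivative \<gamma>2 s) (at s)"
    "(\<gamma>2 has_field_derivative \<gamma>3 s) (at s)" if "s \<in> S" for s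
  proof -
    have "((\<lambda>s. (deriv ^^ 0) w (V s) * (r s)\<^sup>2) has_field_derivative \<omega>1 s) (at s)"
      unfolding \<omega>1_def by (rule derivative_eq_intros refl w01 r1 that)+ (simp add: algebra_simps eval_nat_numeral)
    then show "(\<omega> has_field_derivative \<omega>1 s) (at s)" by (simp add: \<omega>_def)
    show "(\<omega>1 has_field_derivative \<omega>2 s) (at s)"
      unfolding \<omega>1_def \<omega>2_def by (rule derivative_eq_intros refl w01 r1 that)+ (simp add: algebra_simps eval_nat_numeral)
    show "(\<gamma> has_field_derivative \<gamma>1 s) (at s)"
      using g012(1)[OF that] by (simp add: \<gamma>_def \<gamma>1_def)
    show "(\<gamma>1 has_field_derivative \<gamma>2 s) (at s)"
      unfolding \<gamma>1_def \<gamma>2_def by (rule derivative_eq_intros refl g012 r1 that)+ (simp add: algebra_simps eval_nat_numeral)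
    show "(\<gamma>2 has_field_derivative \<gamma>3 s) (at s)"
      unfolding \<gamma>2_def \<gamma>3_def by (rule derivative_eq_intros refl g012 r1 that)+ (simp add: algebra_simps eval_nat_numeral)
  qed
  have 0: "V 0 = vp" "r 0 = 1" by (simp_all add: V_def r_def)
  have d\<omega>: "deriv \<omega> 0 = \<omega>1 0" "(deriv ^^ 2) \<omega> 0 = \<omega>2 0"
    using higher_deriv_Suc_eq[OF S(1) D(1) S(2), of 0] higher_deriv_Suc_eq[OF S(1) D(1) S(2), of 1]
      higher_deriv_Suc_eq[OF S(1) D(2) S(2), of 0] by (simp_all add: eval_nat_numeral)
  have d\<gamma>: "deriv \<gamma> 0 = \<gamma>1 0" "(deriv ^^ 3) \<gamma> 0 = \<gamma>3 0"
    using higher_deriv_Suc_eq[OF S(1) D(3) S(2), of 0] higher_deriv_Suc_eq[OF S(1) D(3) S(2), of 2]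
      higher_deriv_Suc_eq[OF S(1) D(4) S(2), of 1] higher_deriv_Suc_eq[OF S(1) D(5) S(2), of 0]
    by (simp_all add: eval_nat_numeral)
  show thesis
  proof (rule that[OF d(1) sm\<omega>[unfolded S_def] sm\<gamma>[unfolded S_def]])
    show "\<omega> 0 = 0" "\<gamma> 0 = g vp" using w by (simp_all add: \<omega>_def \<gamma>_def 0)
    show "deriv \<omega> 0 = deriv w vp" using w by (simp add: d\<omega> \<omega>1_def 0)
    \<comment> \<open>At 0 the second derivative is w'' + 6 kappa w'; this is the origin of the 6 in
      \<open>\<kappa>\<close>.\<close>
    show "(deriv ^^ 2) \<omega> 0 = 0" using w by (simp add: d\<omega> \<omega>2_def 0 \<kappa>_def)
    show "deriv \<gamma> 0 = 0" using g by (simp add: d\<gamma> \<gamma>1_def 0)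
    \<comment> \<open>As g' vanishes, the third derivative of \<open>\<gamma>\<close> at 0 is g''' +
      6 kappa g'', and 6 kappa w' = -w''.\<close>
    show "deriv w vp * (deriv ^^ 3) \<gamma> 0 =
        (deriv ^^ 3) g vp * deriv w vp - (deriv ^^ 2) g vp * (deriv ^^ 2) w vp"
      using g w(2) by (simp add: d\<gamma> \<gamma>3_def 0 \<kappa>_def field_simps)
  next
    fix s assume "s \<in> {-d<..<d}"
    then have s: "s \<in> S" by (simp add: S_def)
    have "((B \<circ> V) has_vector_derivative (r s)\<^sup>2 *\<^sub>R (w (V s) / 2) *\<^sub>R null2 (g (V s))) (at s)"
      by (rule vector_diff_chain_at)
        (use V1[OF s] B[OF SJ[OF s]] in \<open>simp_all add: has_real_derivative_iff_has_vector_derivative\<close>)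
    then show "((\<lambda>s. B (vp + s / (1 - \<kappa> * s))) has_vector_derivative (\<omega> s / 2) *\<^sub>R null2 (\<gamma> s)) (at s)"
      by (simp add: \<omega>_def \<gamma>_def V_def r_def o_def mult.commute)
  qed
qed

text \<open>The source diffeomorphism. On the half-planes where the denominators are positive, t /
  (1 + kappa t) and s / (1 - kappa s) are mutually inverse.\<close>

lemma local_diffeo_at_moebius:
  fixes up vp \<kappa> :: real
  shows "local_diffeo_at (\<lambda>(u, v). (u - up, (v - vp) / (1 + \<kappa> * (v - vp)))) (up, vp)"
  unfolding local_diffeo_at_def
proof (intro exI conjI)
  let ?f = "\<lambda>(u, v). (u - up, (v - vp) / (1 + \<kappa> * (v - vp)))"
  let ?g = "\<lambda>(x, s). (up + x, vp + s / (1 - \<kappa> * s))"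
  let ?U = "{z :: real \<times> real. 0 < 1 + \<kappa> * (snd z - vp)}"
  let ?V = "{z :: real \<times> real. 0 < 1 - \<kappa> * snd z}"
  show U: "open ?U" and V: "open ?V" by (intro open_Collect_less continuous_intros)+
  show "(up, vp) \<in> ?U" by simp
  have fg: "?f z \<in> ?V" "?g (?f z) = z" if zU: "z \<in> ?U" for z
  proof -
    obtain u v where z: "z = (u, v)" by (cases z)
    define t where "t = v - vp"
    have t: "1 + \<kappa> * t > 0" using zU by (simp add: z t_def)
    have e: "1 - \<kappa> * t / (1 + \<kappa> * t) = 1 / (1 + \<kappa> * t)" using t by (simp add: field_simps)
    show "?f z \<in> ?V" using t e by (simp add: z flip: t_def)
    have "?g (?f z) = (u, vp + t / (1 + \<kappa> * t) / (1 - \<kappa> * t / (1 + \<kappa> * t)))" by (simp add: z t_def)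
    then show "?g (?f z) = z" unfolding e using t by (simp add: z t_def)
  qed
  have gf: "?g z \<in> ?U" "?f (?g z) = z" if zV: "z \<in> ?V" for z
  proof -
    obtain x s where z: "z = (x, s)" by (cases z)
    have t: "1 - \<kappa> * s > 0" using zV by (simp add: z)
    have e: "1 + \<kappa> * s / (1 - \<kappa> * s) = 1 / (1 - \<kappa> * s)" using t by (simp add: field_simps)
    show "?g z \<in> ?U" using t e by (simp add: z)
    have "?f (?g z) = (x, s / (1 - \<kappa> * s) / (1 + \<kappa> * s / (1 - \<kappa> * s)))" by (simp add: z)
    then show "?f (?g z) = z" unfolding e using t by (simp add: z)
  qed
  show "?f ` ?U = ?V"
  proof
    show "?f ` ?U \<subseteq> ?V" using fg(1) by blast
    show "?V \<subseteq> ?f ` ?U" using gf by (metis (no_types, lifting) image_eqI subsetI)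
  qed
  show "\<forall>y\<in>?U. ?g (?f y) = y" using fg(2) by blast
  show "\<forall>z\<in>?V. ?f (?g z) = z" using gf(2) by blast
  have fs: "smooth_on X fst" "smooth_on X snd" if "open X" for X :: "(real \<times> real) set"
    using that by (auto intro: smooth_on_bounded_linear bounded_linear_fst bounded_linear_snd)
  show "smooth_on ?U ?f"
    unfolding case_prod_beta
    by (intro smooth_on_Pair smooth_on_divide smooth_on_add smooth_on_diff smooth_on_mult smooth_on_const fs U) auto
  show "smooth_on ?V ?g"
    unfolding case_prod_beta
    by (intro smooth_on_Pair smooth_on_divide smooth_on_add smooth_on_diff smooth_on_mult smooth_on_const fs V) auto
qed

section \<open>The target diffeomorphism and the normal form\<close>

lemma smooth_on_vec_antiderivative:
  fixes A :: "real \<Rightarrow> real^'n"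
  assumes "open I" "\<And>u. u \<in> I \<Longrightarrow> (A has_vector_derivative A' u) (at u)" "smooth_on I A'"
  shows "smooth_on I A"
proof (rule smooth_on_vec[OF assms(1)])
  show "smooth_on I (\<lambda>u. A u $ i)" for i
    by (rule smooth_on_antiderivative[OF assms(1) smooth_on_vec_nth[OF assms(1,3), of i]
          has_vector_derivative_vec_nth[OF assms(2)]])
qed

lemma has_derivative_curve_component:
  fixes A :: "real \<Rightarrow> real^3"
  assumes "(A has_vector_derivative a) (at (x $ i + t))"
  shows "((\<lambda>z::real^3. A (z $ i + t)) has_derivative (\<lambda>h. h $ i *\<^sub>R a)) (at x)"
proof (rule has_derivative_compose[where f = "\<lambda>z::real^3. z $ i + t" and g = A])
  show "((\<lambda>z::real^3. z $ i + t) has_derivative (\<lambda>h. h $ i)) (at x)"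
    by (auto intro!: derivative_eq_intros bounded_linear_imp_has_derivative bounded_linear_vec_nth)
qed (use assms in \<open>simp add: has_vector_derivative_def\<close>)

text \<open>The r-term of the third column is parallel to the second column and drops out. What
  remains is the determinant of \<open>null1 a\<close>, \<open>null2 b\<close> and
  \<open>null2_deriv b\<close>, which is 4 (1 - a b)^2.\<close>

lemma det_null_basis:
  "det (matrix (\<lambda>h::real^3. h $ 1 *\<^sub>R p *\<^sub>R null1 a + h $ 2 *\<^sub>R q *\<^sub>R null2 b
      + h $ 3 *\<^sub>R (r *\<^sub>R null2 b + s *\<^sub>R null2_deriv b))) = 4 * p * q * s * (1 - a * b)\<^sup>2"
  by (simp add: det_3 matrix_def axis_def null_nth null2_deriv_nth power2_eq_square)
    (simp add: algebra_simps)

text \<open>Near p one has f = \<open>\<Phi>\<close> o \<open>cuspidal_edge_25\<close> o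
  \<open>\<sigma>\<close>, so the local inverse \<open>\<tau>\<close> of \<open>\<Phi>\<close>
  carries f to the model.\<close>

theorem A_equivalent_cuspidal_edge_25_sufficient:
  fixes f :: "real \<times> real \<Rightarrow> real^3"
  assumes f: "f = (\<lambda>(u, v). A u + B v)"
    and A: "\<And>u. u \<in> I \<Longrightarrow> (A has_vector_derivative (w1 u / 2) *\<^sub>R null1 (g1 u)) (at u)"
    and B: "\<And>v. v \<in> J \<Longrightarrow> (B has_vector_derivative (w v / 2) *\<^sub>R null2 (g v)) (at v)"
    and I: "open I" "open J" "up \<in> I" "vp \<in> J" "smooth_on I g1" "smooth_on I w1" "smooth_on J g" "smooth_on J w"
    and w: "w1 up \<noteq> 0" "w vp = 0" "deriv w vp \<noteq> 0" "g1 up * g vp \<noteq> 1" "deriv g vp = 0"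
    and cond: "(deriv ^^ 3) g vp * deriv w vp \<noteq> (deriv ^^ 2) g vp * (deriv ^^ 2) w vp"
  shows "A_equivalent_at f (up, vp) cuspidal_edge_25 (0, 0)"
proof -
  define \<kappa> where "\<kappa> = - (deriv ^^ 2) w vp / (6 * deriv w vp)"
  obtain d \<omega> \<gamma> where d: "d > 0" and sm: "smooth_on {-d<..<d} \<omega>" "smooth_on {-d<..<d} \<gamma>"
    and \<omega>: "\<omega> 0 = 0" "deriv \<omega> 0 = deriv w vp" "(deriv ^^ 2) \<omega> 0 = 0"
    and \<gamma>: "\<gamma> 0 = g vp" "deriv \<gamma> 0 = 0"
    and \<gamma>3: "deriv w vp * (deriv ^^ 3) \<gamma> 0 = (deriv ^^ 3) g vp * deriv w vp - (deriv ^^ 2) g vp * (deriv ^^ 2) w vp"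
    and BV: "\<And>s. s \<in> {-d<..<d} \<Longrightarrow>
       ((\<lambda>s. B (vp + s / (1 - \<kappa> * s))) has_vector_derivative (\<omega> s / 2) *\<^sub>R null2 (\<gamma> s)) (at s)"
    by (rule moebius_reparametrization[OF I(2,4,8,7) w(2,3,5) B, folded \<kappa>_def]) (assumption | rule that)+
  define T where "T = {-d\<^sup>2<..<d\<^sup>2}"
  have T: "open T" "0 \<in> T" using d by (auto simp: T_def)
  obtain E F where EF: "smooth_on T E" "smooth_on T F"
    "\<And>s. s \<in> {-d<..<d} \<Longrightarrow> B (vp + s / (1 - \<kappa> * s)) = E (s\<^sup>2) + s ^ 5 *\<^sub>R F (s\<^sup>2)"
    "(E has_vector_derivative (deriv \<omega> 0 / 4) *\<^sub>R null2 (\<gamma> 0)) (at 0)"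
    "F 0 = (1 / 240) *\<^sub>R ((deriv ^^ 4) \<omega> 0 *\<^sub>R null2 (\<gamma> 0) + (4 * deriv \<omega> 0 * (deriv ^^ 3) \<gamma> 0) *\<^sub>R null2_deriv (\<gamma> 0))"
    using null_curve_decomposition[OF d sm \<omega>(1,3) \<gamma>(2) BV] unfolding T_def by blast
  \<comment> \<open>The summands \<open>+ 0\<close> give all three curves the common shape
    \<open>z $ i + t\<close>, so that the same smoothness and derivative rules apply to
    each.\<close>
  define \<Phi> where "\<Phi> = (\<lambda>z::real^3. A (z $ 1 + up) + E (z $ 2 + 0) + z $ 3 *\<^sub>R F (z $ 2 + 0))"
  define \<Omega> where "\<Omega> = {z::real^3. z $ 1 + up \<in> I} \<inter> {z. z $ 2 + 0 \<in> T}"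
  have \<Omega>: "open \<Omega>" "0 \<in> \<Omega>"
  proof -
    have "open ((\<lambda>z::real^3. z $ 1 + up) -` I)" "open ((\<lambda>z::real^3. z $ 2 + 0) -` T)"
      by (intro open_vimage I T continuous_intros)+
    then show "open \<Omega>" unfolding \<Omega>_def vimage_def by (rule open_Int)
    show "0 \<in> \<Omega>" using I(3) T(2) by (simp add: \<Omega>_def)
  qed
  have nth: "smooth_on \<Omega> (\<lambda>z. z $ i + t)" for i t
    by (intro smooth_on_add smooth_on_const smooth_on_bounded_linear bounded_linear_vec_nth \<Omega>)
  have A_sm: "smooth_on I A"
    using smooth_on_divide[OF I(1,6) smooth_on_const[OF I(1), of 2]]
    by (intro smooth_on_vec_antiderivative[OF I(1) A] smooth_on_scaleR smooth_on_null I) auto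
  have "smooth_on \<Omega> \<Phi>"
    unfolding \<Phi>_def
    by (intro smooth_on_add smooth_on_scaleR \<Omega> smooth_on_compose[OF \<Omega>(1) I(1) _ A_sm nth]
        smooth_on_compose[OF \<Omega>(1) T(1) _ EF(1) nth] smooth_on_compose[OF \<Omega>(1) T(1) _ EF(2) nth]
        smooth_on_bounded_linear bounded_linear_vec_nth) (auto simp: \<Omega>_def)
  moreover have "det (matrix (frechet_derivative \<Phi> (at 0))) \<noteq> 0"
  proof -
    define D where "D = (\<lambda>h::real^3. h $ 1 *\<^sub>R (w1 up / 2) *\<^sub>R null1 (g1 up)
      + h $ 2 *\<^sub>R (deriv w vp / 4) *\<^sub>R null2 (g vp) + h $ 3 *\<^sub>R F 0)"
    \<comment> \<open>The value of \<open>F'\<close> does not survive in D: the product rule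
      multiplies it by z $ 3, which is 0 at the origin.\<close>
    obtain F' where F': "(F has_vector_derivative F') (at 0)"
      using smooth_on_has_derivative[OF EF(2) T(2)] vector_derivative_works
      by (metis differentiableI_vector differentiable_def has_vector_derivative_def vector_derivative_works frechet_derivative_works)
    have "((\<lambda>z::real^3. z $ 3 *\<^sub>R F (z $ 2 + 0)) has_derivative
        (\<lambda>h. (0::real^3) $ 3 *\<^sub>R (h $ 2 *\<^sub>R F') + h $ 3 *\<^sub>R F ((0::real^3) $ 2 + 0))) (at 0)"
      by (intro has_derivative_scaleR has_derivative_curve_component bounded_linear_imp_has_derivative bounded_linear_vec_nth)
        (simp add: F')
    then have "(\<Phi> has_derivative D) (at 0)"
      unfolding \<Phi>_def D_def using A[OF I(3)] EF(4) \<omega>(2) \<gamma>(1)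
      by (intro has_derivative_add has_derivative_curve_component) simp_all
    then have "frechet_derivative \<Phi> (at 0) = D" by (rule frechet_derivative_at[symmetric])
    \<comment> \<open>The coefficient of F(0) along \<open>null2_deriv\<close> is 4 w' times the
      third derivative of \<open>\<gamma>\<close>, over 240; by \<open>\<gamma>3\<close> it is
      nonzero exactly under \<open>cond\<close>.\<close>
    moreover have "det (matrix D) \<noteq> 0"
      using det_null_basis[of "w1 up / 2" "g1 up" "deriv w vp / 4" "g vp" "(deriv ^^ 4) \<omega> 0 / 240"
          "4 * deriv \<omega> 0 * (deriv ^^ 3) \<gamma> 0 / 240"] w cond \<gamma>3
      by (auto simp: D_def EF(5) \<gamma>(1) \<omega>(2) scaleR_add_right)
    ultimately show ?thesis by simp
  qed
  ultimately have "local_diffeo_at \<Phi> 0" using local_diffeo_at_if_det_neq_0 \<Omega> by blast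
  then obtain U V \<tau> where U: "open U" "0 \<in> U" "\<And>z. z \<in> U \<Longrightarrow> \<tau> (\<Phi> z) = z" "local_diffeo_at \<tau> (\<Phi> 0)"
    using local_diffeo_at_inverse by metis
  define \<sigma> where "\<sigma> = (\<lambda>(u, v). (u - up, (v - vp) / (1 + \<kappa> * (v - vp))))"
  have \<sigma>: "local_diffeo_at \<sigma> (up, vp)" unfolding \<sigma>_def by (rule local_diffeo_at_moebius)
  define N where "N = {z :: real \<times> real. 0 < 1 + \<kappa> * (snd z - vp)}"
  have N: "open N" unfolding N_def by (intro open_Collect_less continuous_intros)
  have c\<sigma>: "continuous_on N \<sigma>"
    unfolding \<sigma>_def case_prod_beta by (intro continuous_intros) (auto simp: N_def)
  define Q where "Q = {z :: real \<times> real. snd z \<in> {-d<..<d}} \<inter> {z. cuspidal_edge_25 z \<in> U}"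
  have Q: "open Q"
  proof -
    have "continuous_on UNIV cuspidal_edge_25"
    proof (rule continuous_on_componentwise[THEN iffD2], rule ballI)
      fix b :: "real^3" assume "b \<in> Basis"
      then obtain i where b: "b = axis i 1" by (auto simp: Basis_vec_def)
      show "continuous_on UNIV (\<lambda>x. cuspidal_edge_25 x \<bullet> b)"
        using exhaust_3[of i]
        by (elim disjE; simp add: b inner_axis cuspidal_edge_25_def case_prod_beta; intro continuous_intros)
    qed
    then have "open (cuspidal_edge_25 -` U)" using U(1) by (simp add: open_vimage)
    moreover have "open (snd -` {-d<..<d} :: (real \<times> real) set)" by (intro open_vimage continuous_intros)
    ultimately show ?thesis unfolding Q_def vimage_def by (intro open_Int)
  qed
  have cusp0: "cuspidal_edge_25 (0, 0) = 0"
    by (simp add: cuspidal_edge_25_def vec_eq_iff forall_3)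
  have main: "f z = \<Phi> (cuspidal_edge_25 (\<sigma> z))" if z: "z \<in> N" "\<sigma> z \<in> Q" for z
  proof -
    obtain u v where uv: "z = (u, v)" by (cases z)
    define t where "t = v - vp"
    define s where "s = t / (1 + \<kappa> * t)"
    have t: "1 + \<kappa> * t > 0" using z by (simp add: N_def uv t_def)
    have e: "1 - \<kappa> * s = 1 / (1 + \<kappa> * t)" using t by (simp add: s_def field_simps)
    have "vp + s / (1 - \<kappa> * s) = v" unfolding e using t by (simp add: s_def t_def)
    moreover have \<sigma>z: "\<sigma> z = (u - up, s)" by (simp add: \<sigma>_def uv s_def t_def)
    ultimately have "B v = E (s\<^sup>2) + s ^ 5 *\<^sub>R F (s\<^sup>2)" using EF(3)[of s] z(2) by (simp add: Q_def)
    then show ?thesis unfolding \<sigma>z by (simp add: f uv \<Phi>_def cuspidal_edge_25_def)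
  qed
  have p: "(up, vp) \<in> N" "\<sigma> (up, vp) = (0, 0)" by (simp_all add: N_def \<sigma>_def)
  have p': "(0, 0) \<in> Q" using d U(2) by (simp add: Q_def cusp0)
  have fp: "f (up, vp) = \<Phi> 0" using main p p' cusp0 by metis
  have "open (\<sigma> -` Q \<inter> N)" using continuous_on_open_vimage[OF N] c\<sigma> Q by blast
  then show ?thesis
    unfolding A_equivalent_at_def
  proof (intro exI[of _ \<sigma>] exI[of _ \<tau>] exI[of _ "\<sigma> -` Q \<inter> N"] conjI ballI)
    show "(up, vp) \<in> \<sigma> -` Q \<inter> N" using p p' by simp
    show "\<tau> (f (up, vp)) = cuspidal_edge_25 (0, 0)" using U(2,3) by (simp add: fp cusp0)
    show "local_diffeo_at \<tau> (f (up, vp))" using U(4) fp by simp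
    show "\<tau> (f z) = cuspidal_edge_25 (\<sigma> z)" if "z \<in> \<sigma> -` Q \<inter> N" for z
      using that U(3)[of "cuspidal_edge_25 (\<sigma> z)"] main[of z] by (simp add: Q_def)
  qed (use \<sigma> p in auto)
qed

theorem theorem4p3:
  fixes I J :: "real set" and g1 w1 g2 w2 :: "real \<Rightarrow> real"
    and u0 v0 up vp :: real and c :: "real^3"
  defines "f \<equiv> weierstrass g1 w1 g2 w2 u0 v0 c"
      and "n \<equiv> wnormal g1 g2"
  assumes surf: "gen_timelike_minimal I J g1 w1 g2 w2 u0 v0 c"
    and p_in: "up \<in> I" "vp \<in> J"
    and nondeg: "nondegenerate_singular f n (up, vp)"
    and rank1: "rank_d f (up, vp) = 1"
    and w2p: "w2 vp = 0"
    and not_front: "\<not> front_at f n (up, vp)"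
  shows "A_equivalent_at f (up, vp) cuspidal_edge_25 (0, 0) \<longleftrightarrow>
         deriv (\<lambda>v. deriv (deriv g2) v / deriv w2 v) vp \<noteq> 0"
proof -
  have I: "open I" "open J" "smooth_on I g1" "smooth_on I w1" "smooth_on J g2" "smooth_on J w2"
    using surf by (auto simp: gen_timelike_minimal_def Let_def)
  note data = non_front_nondegenerate_data[OF surf _ _ p_in nondeg rank1 w2p not_front, OF f_def[THEN meta_eq_to_obj_eq] n_def[THEN meta_eq_to_obj_eq]]
  obtain A B where AB: "f = (\<lambda>(u, v). A u + B v)"
    "\<And>u. u \<in> I \<Longrightarrow> (A has_vector_derivative (w1 u / 2) *\<^sub>R null1 (g1 u)) (at u)"
    "\<And>v. v \<in> J \<Longrightarrow> (B has_vector_derivative (w2 v / 2) *\<^sub>R null2 (g2 v)) (at v)"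
    using weierstrass_split[OF surf] unfolding f_def by metis
  \<comment> \<open>The quotient rule turns the invariant of the statement into g''' w' - g'' w''
    divided by w'^2, the form used by both implications.\<close>
  have "((\<lambda>v. deriv (deriv g2) v / deriv w2 v) has_field_derivative
      ((deriv ^^ 3) g2 vp * deriv w2 vp - (deriv ^^ 2) g2 vp * (deriv ^^ 2) w2 vp) / (deriv w2 vp * deriv w2 vp)) (at vp)"
    using DERIV_divide[OF smooth_on_has_higher_deriv[OF I(2,5) p_in(2), of 2]
        smooth_on_has_higher_deriv[OF I(2,6) p_in(2), of 1]] data(2)
    by (simp add: eval_nat_numeral)
  from DERIV_imp_deriv[OF this] have "deriv (\<lambda>v. deriv (deriv g2) v / deriv w2 v) vp \<noteq> 0 \<longleftrightarrow>
      (deriv ^^ 3) g2 vp * deriv w2 vp \<noteq> (deriv ^^ 2) g2 vp * (deriv ^^ 2) w2 vp"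
    using data(2) by simp
  then show ?thesis
    using A_equivalent_cuspidal_edge_25_necessary[OF AB I(1,2) p_in I(5,6) w2p data(2,4)]
      A_equivalent_cuspidal_edge_25_sufficient[OF AB I(1,2) p_in I(3-6) data(1) w2p data(2,3,4)]
    by blast
qed

end
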